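(* Let $p,q$ be relatively prime positive integers with $p^2<\sqrt{2}\,q^2<2\sqrt{2}\,p^2$. At an arbitrary point of the orbifold $\mathcal{O}_{p,q}(1)$ (defined in the context), let $k$, $0<k<1$, be the pinching constant at that point, i.e. the ratio of the minimal to the maximal sectional curvature at that point. Then: (i) if $p\leq q$, $$\frac14-\frac34\,\frac{q^2-p^2}{p^2+q^2}\ \leq\ k\ \leq\ \frac14+\frac34\,\frac{q^4-p^4}{p^4+q^4};$$ (ii) if $p\geq q$, $$\frac14-\frac34\,\frac{p^4-q^4}{p^4+q^4}\ \leq\ k\ \leq\ \frac14+\frac34\,\frac{p^2-q^2}{p^2+q^2}.$$ As $p\to q$ (i.e. as $p/q\to1$), $k\to\frac14$. Moreover, $k=\frac14$ at every point of $\mathcal{O}_{p,q}(1)$ if and only if $p=q=1$.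
   Context: Let $\mathbb{H}$ be the quaternions with units $i,j,k$, conjugation $\bar h$ and norm $|h|^2=h\bar h$. Let $S^{11}=\{u=(u_0,u_1,u_2)\in\mathbb{H}^3: |u_0|^2+|u_1|^2+|u_2|^2=1\}$ be the unit sphere with its round metric, and let $\mathbb{H}P^2=S^{11}/\sim$, where $(u_0,u_1,u_2)\sim(u_0h,u_1h,u_2h)$ for unit quaternions $h$, with the metric making $S^{11}\to\mathbb{H}P^2$ a Riemannian submersion (so the quaternionic sectional curvature is $4$). For relatively prime positive integers $p,q$, the circle $S^1=\{e^{jt}=\cos t+j\sin t: t\in\mathbb{R}\}$ acts isometrically on $\mathbb{H}P^2$ by $\phi_t[u_0,u_1,u_2]=[e^{jqt}u_0,e^{jpt}u_1,e^{jpt}u_2]$. Put $$\mathcal{L}_{\mathbb{H}}=\{[u_0,u_1,u_2]\in\mathbb{H}P^2: q\bar u_0ju_0+p\bar u_1ju_1+p\bar u_2ju_2=0\},$$ a compact $5$-dimensional submanifold with the induced metric, preserved by the $S^1$-action, which is locally free on it. The quotient $\mathcal{O}_{p,q}(1)=\mathcal{L}_{\mathbb{H}}/S^1$ is a compact $4$-dimensional Riemannian orbifold with the metric making $\mathcal{L}_{\mathbb{H}}\to\mathcal{L}_{\mathbb{H}}/S^1$ a Riemannian submersion; it is the Galicki–Lawson orbifold. Sectional curvatures of the orbifold are computed on local uniformizing charts (equivalently, for local quotients of $\mathcal{L}_{\mathbb{H}}$ by the action). *)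

theory Defs
  imports "HOL-Analysis.Analysis"
begin

section \<open>Quaternions\<close>

datatype quat = Quat (qre: real) (qi: real) (qj: real) (qk: real)

lemma quat_eq_iff: "x = y \<longleftrightarrow> qre x = qre y \<and> qi x = qi y \<and> qj x = qj y \<and> qk x = qk y"
  by (cases x; cases y) simp

instantiation quat :: "{zero, one, plus, minus, uminus, times}"
begin

definition "0 = Quat 0 0 0 0"
definition "1 = Quat 1 0 0 0"
definition "x + y = Quat (qre x + qre y) (qi x + qi y) (qj x + qj y) (qk x + qk y)"
definition "x - y = Quat (qre x - qre y) (qi x - qi y) (qj x - qj y) (qk x - qk y)"
definition "- x = Quat (- qre x) (- qi x) (- qj x) (- qk x)"
definition "x * y = Quat
  (qre x * qre y - qi x * qi y - qj x * qj y - qk x * qk y)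
  (qre x * qi y + qi x * qre y + qj x * qk y - qk x * qj y)
  (qre x * qj y - qi x * qk y + qj x * qre y + qk x * qi y)
  (qre x * qk y + qi x * qj y - qj x * qi y + qk x * qre y)"

instance ..

end

lemma quat_sel [simp]:
  "qre 0 = 0" "qi 0 = 0" "qj 0 = 0" "qk 0 = 0"
  "qre 1 = 1" "qi 1 = 0" "qj 1 = 0" "qk 1 = 0"
  "qre (x + y) = qre x + qre y" "qi (x + y) = qi x + qi y"
  "qj (x + y) = qj x + qj y" "qk (x + y) = qk x + qk y"
  "qre (x - y) = qre x - qre y" "qi (x - y) = qi x - qi y"
  "qj (x - y) = qj x - qj y" "qk (x - y) = qk x - qk y"
  "qre (- x) = - qre x" "qi (- x) = - qi x" "qj (- x) = - qj x" "qk (- x) = - qk x"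
  "qre (x * y) = qre x * qre y - qi x * qi y - qj x * qj y - qk x * qk y"
  "qi (x * y) = qre x * qi y + qi x * qre y + qj x * qk y - qk x * qj y"
  "qj (x * y) = qre x * qj y - qi x * qk y + qj x * qre y + qk x * qi y"
  "qk (x * y) = qre x * qk y + qi x * qj y - qj x * qi y + qk x * qre y"
  by (simp_all add: zero_quat_def one_quat_def plus_quat_def minus_quat_def
      uminus_quat_def times_quat_def)

instance quat :: ring_1
  by standard (simp_all add: quat_eq_iff algebra_simps)

instantiation quat :: real_algebra_1
begin

definition "c *\<^sub>R x = Quat (c * qre x) (c * qi x) (c * qj x) (c * qk x)"

instance
  by standard (simp_all add: quat_eq_iff scaleR_quat_def algebra_simps)

end

lemma quat_scaleR_sel [simp]:
  "qre (c *\<^sub>R x) = c * qre x" "qi (c *\<^sub>R x) = c * qi x"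
  "qj (c *\<^sub>R x) = c * qj x" "qk (c *\<^sub>R x) = c * qk x"
  by (simp_all add: scaleR_quat_def)

instantiation quat :: real_inner
begin

definition "x \<bullet> y = qre x * qre y + qi x * qi y + qj x * qj y + qk x * qk y"
definition "norm (x :: quat) = sqrt (x \<bullet> x)"
definition "sgn (x :: quat) = x /\<^sub>R norm x"
definition "dist (x :: quat) y = norm (x - y)"
definition "(uniformity :: (quat \<times> quat) filter) =
  (INF e\<in>{0<..}. principal {(x, y). dist x y < e})"
definition "open (U :: quat set) \<longleftrightarrow>
  (\<forall>x\<in>U. eventually (\<lambda>(x', y). x' = x \<longrightarrow> y \<in> U) uniformity)"

instance
proof
  fix x y z :: quat and r :: real and S :: "quat set"
  show "dist x y = norm (x - y)" by (rule dist_quat_def)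
  show "sgn x = x /\<^sub>R norm x" by (rule sgn_quat_def)
  show "(uniformity :: (quat \<times> quat) filter) = (INF e\<in>{0<..}. principal {(x, y). dist x y < e})"
    by (rule uniformity_quat_def)
  show "open S \<longleftrightarrow> (\<forall>x\<in>S. eventually (\<lambda>(x', y). x' = x \<longrightarrow> y \<in> S) uniformity)"
    by (rule open_quat_def)
  show "x \<bullet> y = y \<bullet> x" "(x + y) \<bullet> z = x \<bullet> z + y \<bullet> z" "(r *\<^sub>R x) \<bullet> y = r * (x \<bullet> y)"
    by (simp_all add: inner_quat_def algebra_simps)
  show "0 \<le> x \<bullet> x" by (simp add: inner_quat_def)
  have sq0: "a * a + b * b + c * c + d * d = 0 \<longleftrightarrow> a = 0 \<and> b = 0 \<and> c = 0 \<and> d = 0" for a b c d :: real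
    by (simp add: add_nonneg_eq_0_iff)
  show "x \<bullet> x = 0 \<longleftrightarrow> x = 0"
    by (simp add: inner_quat_def sq0 quat_eq_iff)
  show "norm x = sqrt (x \<bullet> x)" by (rule norm_quat_def)
qed

end

instantiation quat :: euclidean_space
begin

definition "Basis = {Quat 1 0 0 0, Quat 0 1 0 0, Quat 0 0 1 0, Quat 0 0 0 1}"

instance
proof
  fix u v x :: quat
  show "(Basis :: quat set) \<noteq> {}" "finite (Basis :: quat set)"
    by (simp_all add: Basis_quat_def)
  show "u \<bullet> v = (if u = v then 1 else 0)" if "u \<in> Basis" "v \<in> Basis"
    using that unfolding Basis_quat_def insert_iff empty_iff simp_thms
    by (elim disjE; hypsubst; simp add: inner_quat_def)
  show "(\<forall>u\<in>Basis. x \<bullet> u = 0) \<longleftrightarrow> x = 0"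
    by (simp add: Basis_quat_def inner_quat_def) (simp add: quat_eq_iff)
qed

end

definition qcnj :: "quat \<Rightarrow> quat" where
  "qcnj h = Quat (qre h) (- qi h) (- qj h) (- qk h)"

definition unit_j :: quat where
  "unit_j = Quat 0 0 1 0"

definition expj :: "real \<Rightarrow> quat" where
  "expj t = of_real (cos t) + unit_j * of_real (sin t)"

text \<open>The norm coming from the inner product is the one of the quaternion algebra.\<close>

lemma norm_quat_mult_qcnj: "of_real ((norm h)\<^sup>2) = h * qcnj h"
proof -
  have "(norm h)\<^sup>2 = qre h * qre h + qi h * qi h + qj h * qj h + qk h * qk h"
    by (simp add: power2_norm_eq_inner inner_quat_def)
  then show ?thesis
    unfolding of_real_def by (simp only:) (simp add: quat_eq_iff qcnj_def)
qed


section \<open>Smooth maps and sectional curvature in coordinates\<close>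

primrec Ck_on :: "nat \<Rightarrow> 'a::real_normed_vector set \<Rightarrow> ('a \<Rightarrow> 'b::real_normed_vector) \<Rightarrow> bool" where
  "Ck_on 0 S f \<longleftrightarrow> continuous_on S f"
| "Ck_on (Suc n) S f \<longleftrightarrow> (\<forall>x\<in>S. f differentiable (at x)) \<and>
     (\<forall>v. Ck_on n S (\<lambda>x. frechet_derivative f (at x) v))"

definition smooth_on :: "'a::real_normed_vector set \<Rightarrow> ('a \<Rightarrow> 'b::real_normed_vector) \<Rightarrow> bool" where
  "smooth_on S f \<longleftrightarrow> (\<forall>n. Ck_on n S f)"

definition pderiv_at :: "(real^'n \<Rightarrow> real) \<Rightarrow> 'n \<Rightarrow> real^'n \<Rightarrow> real" where
  "pderiv_at f i x = frechet_derivative f (at x) (axis i 1)"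

text \<open>In this section \<open>g x\<close> is the Gram matrix, at the point \<open>x\<close>, of a Riemannian metric on an
  open subset of \<open>real^'n\<close>, with respect to the coordinate vector fields.\<close>

definition christoffel :: "(real^'n \<Rightarrow> real^'n^'n) \<Rightarrow> 'n \<Rightarrow> 'n \<Rightarrow> 'n \<Rightarrow> real^'n \<Rightarrow> real" where
  "christoffel g k i j x = (\<Sum>l\<in>UNIV. matrix_inv (g x) $ k $ l *
     (pderiv_at (\<lambda>y. g y $ j $ l) i x + pderiv_at (\<lambda>y. g y $ i $ l) j x
      - pderiv_at (\<lambda>y. g y $ i $ j) l x)) / 2"

text \<open>The component \<open>l\<close> of \<open>R(\<partial>\<^sub>i, \<partial>\<^sub>j) \<partial>\<^sub>k\<close>, where
  \<open>R(X,Y)Z = \<nabla>\<^sub>X \<nabla>\<^sub>Y Z - \<nabla>\<^sub>Y \<nabla>\<^sub>X Z - \<nabla>\<^bsub>[X,Y]\<^esub> Z\<close>.\<close>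

definition riemann :: "(real^'n \<Rightarrow> real^'n^'n) \<Rightarrow> 'n \<Rightarrow> 'n \<Rightarrow> 'n \<Rightarrow> 'n \<Rightarrow> real^'n \<Rightarrow> real" where
  "riemann g l i j k x =
     pderiv_at (christoffel g l j k) i x - pderiv_at (christoffel g l i k) j x
     + (\<Sum>m\<in>UNIV. christoffel g l i m x * christoffel g m j k x
                - christoffel g l j m x * christoffel g m i k x)"

definition curvature_op ::
    "(real^'n \<Rightarrow> real^'n^'n) \<Rightarrow> real^'n \<Rightarrow> real^'n \<Rightarrow> real^'n \<Rightarrow> real^'n \<Rightarrow> real^'n" where
  "curvature_op g x v w z =
     (\<chi> l. \<Sum>i\<in>UNIV. \<Sum>j\<in>UNIV. \<Sum>k\<in>UNIV. riemann g l i j k x * v $ i * w $ j * z $ k)"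

definition metric_inner :: "(real^'n \<Rightarrow> real^'n^'n) \<Rightarrow> real^'n \<Rightarrow> real^'n \<Rightarrow> real^'n \<Rightarrow> real" where
  "metric_inner g x v w = v \<bullet> (g x *v w)"

definition sectional_curvature ::
    "(real^'n \<Rightarrow> real^'n^'n) \<Rightarrow> real^'n \<Rightarrow> real^'n \<Rightarrow> real^'n \<Rightarrow> real" where
  "sectional_curvature g x v w =
     metric_inner g x (curvature_op g x v w w) v /
     (metric_inner g x v v * metric_inner g x w w - (metric_inner g x v w)\<^sup>2)"


section \<open>The quaternionic projective plane and the Galicki-Lawson orbifold\<close>

type_synonym quat3 = "quat \<times> quat \<times> quat"

definition sphere11 :: "quat3 set" where
  "sphere11 = {(u0, u1, u2). (norm u0)\<^sup>2 + (norm u1)\<^sup>2 + (norm u2)\<^sup>2 = 1}"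

fun rmult :: "quat3 \<Rightarrow> quat \<Rightarrow> quat3" where
  "rmult (u0, u1, u2) h = (u0 * h, u1 * h, u2 * h)"

definition hp_class :: "quat3 \<Rightarrow> quat3 set" where
  "hp_class u = {rmult u h | h. norm h = 1}"

definition HP2 :: "quat3 set set" where
  "HP2 = hp_class ` sphere11"

fun circle_lift :: "nat \<Rightarrow> nat \<Rightarrow> real \<Rightarrow> quat3 \<Rightarrow> quat3" where
  "circle_lift p q t (u0, u1, u2) =
     (expj (real q * t) * u0, expj (real p * t) * u1, expj (real p * t) * u2)"

definition circle_action :: "nat \<Rightarrow> nat \<Rightarrow> real \<Rightarrow> quat3 set \<Rightarrow> quat3 set" where
  "circle_action p q t X = circle_lift p q t ` X"

fun moment :: "nat \<Rightarrow> nat \<Rightarrow> quat3 \<Rightarrow> quat" where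
  "moment p q (u0, u1, u2) = of_nat q * (qcnj u0 * unit_j * u0)
     + of_nat p * (qcnj u1 * unit_j * u1) + of_nat p * (qcnj u2 * unit_j * u2)"

definition LH :: "nat \<Rightarrow> nat \<Rightarrow> quat3 set set" where
  "LH p q = {hp_class u | u. u \<in> sphere11 \<and> moment p q u = 0}"

definition circle_orbit :: "nat \<Rightarrow> nat \<Rightarrow> quat3 set \<Rightarrow> quat3 set set" where
  "circle_orbit p q X = range (\<lambda>t. circle_action p q t X)"

definition GL_orbifold :: "nat \<Rightarrow> nat \<Rightarrow> quat3 set set set" where
  "GL_orbifold p q = circle_orbit p q ` LH p q"

text \<open>A tangent vector of \<open>HP2\<close> at \<open>[u]\<close> is represented by its unique lift to \<open>u\<close> which is orthogonal
  to the fibre of the Hopf map; the tangent space of that fibre at \<open>u\<close> consists of the \<open>u a\<close> with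
  \<open>a\<close> purely imaginary. As the Hopf map is a Riemannian submersion, the metric of \<open>HP2\<close> is the inner
  product of these lifts. \<open>hp_horizontal u w\<close> is the lift of the image of \<open>w\<close> under the
  differential of the Hopf map.\<close>

definition hp_horizontal :: "quat3 \<Rightarrow> quat3 \<Rightarrow> quat3" where
  "hp_horizontal u w = closest_point (orthogonal_comp {rmult u a | a. qre a = 0}) w"

text \<open>The velocity at \<open>t = 0\<close> of \<open>circle_lift p q t u\<close>.\<close>

fun circle_velocity :: "nat \<Rightarrow> nat \<Rightarrow> quat3 \<Rightarrow> quat3" where
  "circle_velocity p q (u0, u1, u2) =
     (real q *\<^sub>R (unit_j * u0), real p *\<^sub>R (unit_j * u1), real p *\<^sub>R (unit_j * u2))"

text \<open>Likewise, a tangent vector of the local quotient of \<open>LH p q\<close> by the circle is represented by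
  its lift orthogonal to the circle orbit, whose direction in \<open>HP2\<close> has the
  lift \<open>hp_horizontal u (circle_velocity p q u)\<close>.\<close>

definition orbifold_horizontal :: "nat \<Rightarrow> nat \<Rightarrow> quat3 \<Rightarrow> quat3 \<Rightarrow> quat3" where
  "orbifold_horizontal p q u w =
     closest_point (orthogonal_comp {hp_horizontal u (circle_velocity p q u)}) (hp_horizontal u w)"

text \<open>Coordinates on the local quotients of \<open>LH p q\<close> by the circle action (equivalently, on
  uniformizing charts) are given by smooth maps \<open>s\<close> into the level set in the sphere such
  that \<open>x \<mapsto> [s x]\<close> is an immersion into \<open>LH p q\<close> transverse to the circle orbits: both spaces
  being of dimension 4, its composition with a local quotient map is a local diffeomorphism.\<close>

definition orbifold_chart :: "nat \<Rightarrow> nat \<Rightarrow> (real^4) set \<Rightarrow> (real^4 \<Rightarrow> quat3) \<Rightarrow> bool" where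
  "orbifold_chart p q U s \<longleftrightarrow> open U \<and> smooth_on U s \<and>
     (\<forall>x\<in>U. s x \<in> sphere11 \<and> moment p q (s x) = 0) \<and>
     (\<forall>x\<in>U. \<forall>v. orbifold_horizontal p q (s x) (frechet_derivative s (at x) v) = 0 \<longrightarrow> v = 0)"

text \<open>The metric which makes the projection onto the local quotient a Riemannian submersion.\<close>

definition orbifold_metric :: "nat \<Rightarrow> nat \<Rightarrow> (real^4 \<Rightarrow> quat3) \<Rightarrow> real^4 \<Rightarrow> real^4^4" where
  "orbifold_metric p q s x = (\<chi> a b.
     orbifold_horizontal p q (s x) (frechet_derivative s (at x) (axis a 1)) \<bullet>
     orbifold_horizontal p q (s x) (frechet_derivative s (at x) (axis b 1)))"

definition sectional_curvatures_at :: "nat \<Rightarrow> nat \<Rightarrow> quat3 set set \<Rightarrow> real set" where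
  "sectional_curvatures_at p q P =
     {sectional_curvature (orbifold_metric p q s) x v w | U s x v w.
        orbifold_chart p q U s \<and> x \<in> U \<and> circle_orbit p q (hp_class (s x)) = P \<and>
        v \<noteq> w \<and> independent {v, w}}"

definition pinching :: "nat \<Rightarrow> nat \<Rightarrow> quat3 set set \<Rightarrow> real" where
  "pinching p q P = (LEAST K. K \<in> sectional_curvatures_at p q P) /
                    (GREATEST K. K \<in> sectional_curvatures_at p q P)"

definition admissible :: "nat \<Rightarrow> nat \<Rightarrow> bool" where
  "admissible p q \<longleftrightarrow> p > 0 \<and> q > 0 \<and> coprime p q \<and>
     (real p)\<^sup>2 < sqrt 2 * (real q)\<^sup>2 \<and> sqrt 2 * (real q)\<^sup>2 < 2 * sqrt 2 * (real p)\<^sup>2"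

end

theory Submission
  imports Defs
begin

text \<open>
  Let \<open>D u = (q j u\<^sub>0, p j u\<^sub>1, p j u\<^sub>2)\<close> be the lift of the Killing field. At a point \<open>u\<close> of the zero level
  the horizontal space of the quotient is the quaternionic line \<open>w H\<close> orthogonal to \<open>u\<close> and \<open>D u\<close>, which
  has curvature 4 in the projective plane. Here \<open>H\<close> denotes the quaternions. On this line the compression of \<open>D\<close> is multiplication by an imaginary
  quaternion \<open>a\<close>, and the Gauss equation and O'Neill's formula together give, for orthonormal \<open>X\<close>, \<open>Y\<close>,
  the sectional curvature \<open>4 - 2 \<lambda> + 6 \<langle>D X, Y\<rangle>\<^sup>2 / |D u|\<^sup>2\<close>, where \<open>\<lambda> = |a|\<^sup>2 / |D u|\<^sup>2\<close> and
  \<open>\<langle>D X, Y\<rangle>\<^sup>2 / |D u|\<^sup>2\<close> ranges over \<open>[0, \<lambda>]\<close>. Hence the pinching constant is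
  \<open>(4 - 2 \<lambda>) / (4 + 4 \<lambda>)\<close>, a decreasing function of \<open>\<lambda>\<close> with value 1/4 at 1. Parseval's identity in the frame
  \<open>u\<close>, \<open>D u\<close>, \<open>w\<close> yields \<open>\<lambda> = p\<^sup>4 q\<^sup>2 / |D u|\<^sup>6\<close>, and \<open>|D u|\<^sup>2\<close> lies between \<open>p\<^sup>2\<close> (attained where
  \<open>u\<^sub>0 = 0\<close>) and \<open>p q\<close>, so that \<open>\<lambda>\<close> lies between \<open>q\<^sup>2 / p\<^sup>2\<close> and \<open>p / q\<close>.
\<close>

section \<open>Iterated directional derivatives\<close>

text \<open>Sectional curvature is defined through Christoffel symbols in charts, so the Gauss and
  O'Neill terms are obtained in a single computation: derivatives of maps into H^3 along a chart are
  corrected by the connection forms of the Hopf fibre and of the circle orbit, and the commutators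
  and normal components of this corrected derivative give the curvature tensor. It becomes explicit
  because the moment equation makes \<open>u\<close> and \<open>D u\<close> orthogonal over the
  quaternions, not merely over the reals; the horizontal space is then one quaternionic line and the
  tensor reduces to quaternion arithmetic. The pinching constant is a quotient of
  \<open>LEAST\<close> and \<open>GREATEST\<close> over all charts through a point. The bounds are
  therefore needed in every chart, the extremal values in at least one, which has to be constructed;
  and all lifts of an orbit must give the same \<lambda>, which holds because \<lambda> depends only
  on the norm of the first entry. The fourth powers in the theorem come from comparing p/q with its
  fourth power.\<close>

lemma Ck_on_cong:
  assumes "open S" "\<And>x. x \<in> S \<Longrightarrow> f x = g x"
  shows "Ck_on n S f \<longleftrightarrow> Ck_on n S g"
  using assms(2)
proof (induction n arbitrary: f g)
  case 0
  then show ?case by (auto cong: continuous_on_cong)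
next
  case (Suc n)
  have diff: "f differentiable (at x) \<longleftrightarrow> g differentiable (at x)" if "x \<in> S" for x
    unfolding differentiable_def
    using has_derivative_transform_within_open[OF _ assms(1) that, of f _ UNIV g]
      has_derivative_transform_within_open[OF _ assms(1) that, of g _ UNIV f] Suc.prems by auto
  have fd: "f differentiable (at x) \<Longrightarrow> frechet_derivative f (at x) = frechet_derivative g (at x)" if "x \<in> S" for x
    using frechet_derivative_transform_within_open[OF _ assms(1) that] Suc.prems by blast
  have "Ck_on n S (\<lambda>x. frechet_derivative f (at x) v) \<longleftrightarrow> Ck_on n S (\<lambda>x. frechet_derivative g (at x) v)"
    if "\<forall>x\<in>S. f differentiable (at x)" for v
    by (rule Suc.IH) (use that fd in auto)
  then show ?case using diff by auto
qed

lemma Ck_on_pred: "Ck_on (Suc n) S f \<Longrightarrow> Ck_on n S f"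
proof (induction n arbitrary: f)
  case 0
  then show ?case
    by (auto intro!: continuous_at_imp_continuous_on differentiable_imp_continuous_within)
next
  case (Suc n)
  then show ?case by (metis Ck_on.simps(2))
qed

lemma Ck_on_const: "Ck_on n S (\<lambda>x. c)"
proof (induction n arbitrary: c)
  case (Suc n)
  then show ?case by simp
qed simp

lemma Ck_on_SucI:
  assumes "open S" "\<And>x. x \<in> S \<Longrightarrow> (f has_derivative f' x) (at x)" "\<And>v. Ck_on n S (\<lambda>x. f' x v)"
  shows "Ck_on (Suc n) S f"
proof -
  have "frechet_derivative f (at x) = f' x" if "x \<in> S" for x
    using frechet_derivative_at[OF assms(2)[OF that]] by simp
  then have "Ck_on n S (\<lambda>x. frechet_derivative f (at x) v)" for v
    using assms(3) Ck_on_cong[OF assms(1), of "\<lambda>x. frechet_derivative f (at x) v" "\<lambda>x. f' x v"] by simp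
  then show ?thesis using assms(2) by (auto simp: differentiable_def)
qed

lemma Ck_on_SucD:
  assumes "Ck_on (Suc n) S f"
  shows "x \<in> S \<Longrightarrow> (f has_derivative frechet_derivative f (at x)) (at x)"
    and "Ck_on n S (\<lambda>x. frechet_derivative f (at x) v)"
  using assms by (auto simp: frechet_derivative_works[symmetric])

lemma Ck_on_bounded_linear:
  assumes "open S" "bounded_linear L" "Ck_on n S f"
  shows "Ck_on n S (\<lambda>x. L (f x))"
  using assms(3)
proof (induction n arbitrary: f)
  case 0
  then show ?case using bounded_linear.continuous_on[OF assms(2)] by simp
next
  case (Suc n)
  show ?case
    by (rule Ck_on_SucI[OF assms(1) bounded_linear.has_derivative[OF assms(2) Ck_on_SucD(1)[OF Suc.prems]]])
      (use Suc.IH[OF Ck_on_SucD(2)[OF Suc.prems]] in auto)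
qed

lemma Ck_on_add:
  assumes "open S" "Ck_on n S f" "Ck_on n S g"
  shows "Ck_on n S (\<lambda>x. f x + g x)"
  using assms(2,3)
proof (induction n arbitrary: f g)
  case 0
  then show ?case by (auto intro: continuous_on_add)
next
  case (Suc n)
  show ?case
    by (rule Ck_on_SucI[OF assms(1) has_derivative_add[OF Ck_on_SucD(1)[OF Suc.prems(1)] Ck_on_SucD(1)[OF Suc.prems(2)]]])
      (use Suc.IH[OF Ck_on_SucD(2)[OF Suc.prems(1)] Ck_on_SucD(2)[OF Suc.prems(2)]] in auto)
qed

text \<open>One induction serves all products that occur: scalar and inner products,
  \<open>hdot\<close>, \<open>rmult\<close> and quaternion multiplication. The product rule pairs a
  derivative with an undifferentiated factor, hence \<open>Ck_on_pred\<close>.\<close>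

lemma Ck_on_bilinear:
  assumes "open S" "bounded_bilinear B" "Ck_on n S f" "Ck_on n S g"
  shows "Ck_on n S (\<lambda>x. B (f x) (g x))"
  using assms(3,4)
proof (induction n arbitrary: f g)
  case 0
  then show ?case using bounded_bilinear.continuous_on[OF assms(2)] by auto
next
  case (Suc n)
  show ?case
    by (rule Ck_on_SucI[OF assms(1) bounded_bilinear.FDERIV[OF assms(2) Ck_on_SucD(1)[OF Suc.prems(1)] Ck_on_SucD(1)[OF Suc.prems(2)]]])
      (auto intro!: Ck_on_add[OF assms(1)] Suc.IH Ck_on_SucD(2)[OF Suc.prems(1)] Ck_on_SucD(2)[OF Suc.prems(2)]
        Ck_on_pred[OF Suc.prems(1)] Ck_on_pred[OF Suc.prems(2)])
qed

text \<open>The exponent is generalized because differentiation lowers it by one. Square roots and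
  reciprocals both come from this case.\<close>

lemma Ck_on_powr:
  fixes f :: "'a::real_normed_vector \<Rightarrow> real"
  assumes "open S" "Ck_on n S f" "\<And>x. x \<in> S \<Longrightarrow> f x > 0"
  shows "Ck_on n S (\<lambda>x. f x powr r)"
  using assms(2)
proof (induction n arbitrary: r)
  case 0
  then show ?case using assms(3) by (auto intro!: continuous_on_powr) (metis less_irrefl)
next
  case (Suc n)
  have der: "((\<lambda>x. f x powr r) has_derivative (\<lambda>v. (r * f x powr (r - 1)) * frechet_derivative f (at x) v)) (at x)"
    if "x \<in> S" for x
  proof -
    have "((\<lambda>y. y powr r) has_derivative (*) (r * f x powr (r - 1))) (at (f x))"
      using has_real_derivative_powr[OF assms(3)[OF that], of r] by (simp add: has_field_derivative_def)
    from has_derivative_compose[OF Ck_on_SucD(1)[OF Suc.prems that] this] show ?thesis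
      by (simp add: o_def)
  qed
  have pr: "Ck_on n S (\<lambda>x. r * f x powr (r - 1))"
    using Ck_on_bounded_linear[OF assms(1) bounded_linear_mult_right Suc.IH[OF Ck_on_pred[OF Suc.prems]]] .
  show ?case
    by (rule Ck_on_SucI[OF assms(1) der])
      (auto intro!: Ck_on_bilinear[OF assms(1) bounded_bilinear_mult pr] Ck_on_SucD(2)[OF Suc.prems])
qed

subsection \<open>Smooth maps\<close>

lemma smooth_onI: "(\<And>n. Ck_on n S f) \<Longrightarrow> smooth_on S f" by (simp add: smooth_on_def)
lemma smooth_on_imp_Ck: "smooth_on S f \<Longrightarrow> Ck_on n S f" by (simp add: smooth_on_def)

lemma smooth_on_cong:
  "open S \<Longrightarrow> (\<And>x. x \<in> S \<Longrightarrow> f x = g x) \<Longrightarrow> smooth_on S f \<longleftrightarrow> smooth_on S g"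
  using Ck_on_cong unfolding smooth_on_def by blast

lemma smooth_on_has_derivative:
  "smooth_on S f \<Longrightarrow> x \<in> S \<Longrightarrow> (f has_derivative frechet_derivative f (at x)) (at x)"
  using smooth_on_imp_Ck Ck_on_SucD(1) by blast

lemma smooth_on_imp_continuous_on: "smooth_on S f \<Longrightarrow> continuous_on S f"
  using smooth_on_imp_Ck[of S f 0] by simp

lemma smooth_on_subset: "smooth_on S f \<Longrightarrow> T \<subseteq> S \<Longrightarrow> smooth_on T f"
proof (rule smooth_onI)
  fix n assume "smooth_on S f" and T: "T \<subseteq> S"
  then have "Ck_on n S f" by (simp add: smooth_on_def)
  then show "Ck_on n T f"
  proof (induction n arbitrary: f)
    case 0
    then show ?case using T continuous_on_subset by auto
  next
    case (Suc n)
    then show ?case using T by auto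
  qed
qed

named_theorems smooth_intros

lemma smooth_on_const [smooth_intros]: "smooth_on S (\<lambda>x. c)"
  by (auto intro: smooth_onI Ck_on_const)

lemma smooth_on_frechet_derivative [smooth_intros]:
  "smooth_on S f \<Longrightarrow> smooth_on S (\<lambda>x. frechet_derivative f (at x) v)"
  using Ck_on_SucD(2) unfolding smooth_on_def by blast

lemma smooth_on_bounded_linear:
  "bounded_linear L \<Longrightarrow> open S \<Longrightarrow> smooth_on S f \<Longrightarrow> smooth_on S (\<lambda>x. L (f x))"
  by (auto intro: smooth_onI smooth_on_imp_Ck Ck_on_bounded_linear)

lemma smooth_on_bilinear:
  "bounded_bilinear B \<Longrightarrow> open S \<Longrightarrow> smooth_on S f \<Longrightarrow> smooth_on S g \<Longrightarrow> smooth_on S (\<lambda>x. B (f x) (g x))"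
  by (auto intro: smooth_onI smooth_on_imp_Ck Ck_on_bilinear)

lemma smooth_on_id [smooth_intros]:
  assumes "open S" shows "smooth_on S (\<lambda>x. x)"
proof (rule smooth_onI)
  fix n show "Ck_on n S (\<lambda>x. x)"
    by (cases n) (auto intro!: Ck_on_SucI[OF assms has_derivative_ident] Ck_on_const)
qed

lemma smooth_on_linear_map:
  "bounded_linear L \<Longrightarrow> open S \<Longrightarrow> smooth_on S L"
  using smooth_on_bounded_linear[OF _ _ smooth_on_id] by blast

lemma smooth_on_add [smooth_intros]:
  "open S \<Longrightarrow> smooth_on S f \<Longrightarrow> smooth_on S g \<Longrightarrow> smooth_on S (\<lambda>x. f x + g x)"
  by (auto intro: smooth_onI smooth_on_imp_Ck Ck_on_add)

lemmas smooth_on_scaleR [smooth_intros] = smooth_on_bilinear[OF bounded_bilinear_scaleR]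
lemmas smooth_on_mult [smooth_intros] = smooth_on_bilinear[OF bounded_bilinear_mult]
lemmas smooth_on_inner [smooth_intros] = smooth_on_bilinear[OF bounded_bilinear_inner]
lemmas smooth_on_minus [smooth_intros] = smooth_on_bounded_linear[OF bounded_linear_minus[OF bounded_linear_ident]]

lemma smooth_on_diff [smooth_intros]:
  "open S \<Longrightarrow> smooth_on S f \<Longrightarrow> smooth_on S g \<Longrightarrow> smooth_on S (\<lambda>x. f x - g x)"
  using smooth_on_add[OF _ _ smooth_on_minus, of S f g] by simp

lemma smooth_on_sum [smooth_intros]:
  "open S \<Longrightarrow> (\<And>i. i \<in> I \<Longrightarrow> smooth_on S (f i)) \<Longrightarrow> smooth_on S (\<lambda>x. \<Sum>i\<in>I. f i x)"
  by (induction I rule: infinite_finite_induct) (auto intro: smooth_intros)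

lemma smooth_on_prod [smooth_intros]:
  fixes f :: "'i \<Rightarrow> 'a::real_normed_vector \<Rightarrow> real"
  shows "open S \<Longrightarrow> (\<And>i. i \<in> I \<Longrightarrow> smooth_on S (f i)) \<Longrightarrow> smooth_on S (\<lambda>x. \<Prod>i\<in>I. f i x)"
  by (induction I rule: infinite_finite_induct) (auto intro: smooth_intros)

lemma smooth_on_powr:
  fixes f :: "'a::real_normed_vector \<Rightarrow> real"
  shows "open S \<Longrightarrow> smooth_on S f \<Longrightarrow> (\<And>x. x \<in> S \<Longrightarrow> f x > 0) \<Longrightarrow> smooth_on S (\<lambda>x. f x powr r)"
  by (auto intro: smooth_onI smooth_on_imp_Ck Ck_on_powr)

lemma smooth_on_sqrt [smooth_intros]:
  fixes f :: "'a::real_normed_vector \<Rightarrow> real"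
  assumes "open S" "smooth_on S f" "\<And>x. x \<in> S \<Longrightarrow> f x > 0"
  shows "smooth_on S (\<lambda>x. sqrt (f x))"
  using smooth_on_powr[OF assms(1-3), where r="1/2"] assms(3)
  by (subst smooth_on_cong[OF assms(1), where g="\<lambda>x. f x powr (1/2)"]) (auto simp: powr_half_sqrt less_imp_le)

lemma smooth_on_divide [smooth_intros]:
  fixes f g :: "'a::real_normed_vector \<Rightarrow> real"
  assumes "open S" "smooth_on S f" "smooth_on S g" "\<And>x. x \<in> S \<Longrightarrow> g x \<noteq> 0"
  shows "smooth_on S (\<lambda>x. f x / g x)"
proof -
  \<comment> \<open>The base of \<open>powr\<close> must be positive while \<open>g\<close> may be
    negative, so the reciprocal is written as \<open>g / (g * g)\<close>.\<close>
  have "smooth_on S (\<lambda>x. f x * (g x * (g x * g x) powr (-1)))"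
    using assms by (intro smooth_intros smooth_on_powr) (auto simp: zero_less_mult_iff linorder_neq_iff)
  moreover have "f x * (g x * (g x * g x) powr (-1)) = f x / g x" if "x \<in> S" for x
    using assms(4)[OF that] by (simp add: powr_minus field_simps)
  ultimately show ?thesis
    using smooth_on_cong[OF assms(1), of "\<lambda>x. f x * (g x * (g x * g x) powr (-1))" "\<lambda>x. f x / g x"] by simp
qed

subsection \<open>Matrices and partial derivatives\<close>

lemma smooth_on_det:
  fixes A :: "'a::real_normed_vector \<Rightarrow> real^'n^'n"
  assumes "open S" "\<And>i j. smooth_on S (\<lambda>x. A x $ i $ j)"
  shows "smooth_on S (\<lambda>x. det (A x))"
  unfolding det_def using assms by (intro smooth_intros) auto

lemma matrix_inv_inverse:
  fixes A :: "real^'n^'n"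
  assumes "det A \<noteq> 0"
  shows "A ** matrix_inv A = mat 1" "matrix_inv A ** A = mat 1"
  using assms unfolding invertible_det_nz[symmetric] invertible_def matrix_inv_def
  by (metis (mono_tags, lifting) someI_ex)+

text \<open>Cramer's rule presents the entries of the inverse as quotients of determinants, which
  makes their smooth dependence on the matrix visible.\<close>

lemma matrix_inv_eq_cramer:
  fixes A :: "real^'n^'n"
  assumes "det A \<noteq> 0"
  shows "matrix_inv A $ k $ l = det (\<chi> i j. if j = k then axis l 1 $ i else A $ i $ j) / det A"
proof -
  have "A *v (matrix_inv A *v axis l 1) = axis l 1"
    by (simp add: matrix_vector_mul_assoc matrix_inv_inverse[OF assms])
  then have "matrix_inv A *v axis l 1 = (\<chi> k. det (\<chi> i j. if j = k then axis l 1 $ i else A $ i $ j) / det A)"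
    using cramer[OF assms] by blast
  moreover have "(matrix_inv A *v axis l 1) $ k = matrix_inv A $ k $ l"
    by (simp add: matrix_vector_mult_basis column_def)
  ultimately show ?thesis by simp
qed

lemma smooth_on_matrix_inv:
  fixes A :: "'a::real_normed_vector \<Rightarrow> real^'n^'n"
  assumes "open S" "\<And>i j. smooth_on S (\<lambda>x. A x $ i $ j)" "\<And>x. x \<in> S \<Longrightarrow> det (A x) \<noteq> 0"
  shows "smooth_on S (\<lambda>x. matrix_inv (A x) $ k $ l)"
proof -
  have "smooth_on S (\<lambda>x. det (\<chi> i j. if j = k then axis l 1 $ i else A x $ i $ j) / det (A x))"
  proof (intro smooth_intros smooth_on_det assms)
    fix i j
    show "smooth_on S (\<lambda>x. (\<chi> i j. if j = k then axis l 1 $ i else A x $ i $ j) $ i $ j)"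
      by (cases "j = k") (use assms(2) in \<open>auto intro: smooth_intros\<close>)
  qed auto
  then show ?thesis
    using smooth_on_cong[OF assms(1)] matrix_inv_eq_cramer[OF assms(3)] by (metis (no_types, lifting))
qed

text \<open>A version of \<open>pderiv_at\<close> with vector values, since charts and frames take
  values in \<open>quat3\<close>.\<close>

definition pd :: "'n \<Rightarrow> (real^'n \<Rightarrow> 'b::real_normed_vector) \<Rightarrow> real^'n \<Rightarrow> 'b" where
  "pd i f x = frechet_derivative f (at x) (axis i 1)"

lemma pderiv_at_eq_pd: "pderiv_at f i x = pd i f x"
  by (simp add: pderiv_at_def pd_def)

lemma smooth_on_pd [smooth_intros]: "smooth_on S f \<Longrightarrow> smooth_on S (pd i f)"
  using smooth_on_frechet_derivative[of S f "axis i 1"] unfolding pd_def[abs_def] .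

lemma pd_eqI: "(f has_derivative f') (at x) \<Longrightarrow> pd i f x = f' (axis i 1)"
  by (metis frechet_derivative_at pd_def)

lemma pd_cong:
  assumes "open S" "x \<in> S" "smooth_on S f" "\<And>y. y \<in> S \<Longrightarrow> f y = g y"
  shows "pd i f x = pd i g x"
  using frechet_derivative_transform_within_open[OF differentiableI[OF smooth_on_has_derivative[OF assms(3,2)]] assms(1,2,4)]
  by (simp add: pd_def)

lemma pd_const [simp]: "pd i (\<lambda>x. c) x = 0" by (simp add: pd_def)

context
  fixes S :: "(real^'n) set" and x :: "real^'n"
  assumes xS: "x \<in> S"
begin

lemma pd_bilinear:
  "bounded_bilinear B \<Longrightarrow> smooth_on S f \<Longrightarrow> smooth_on S g \<Longrightarrow>
    pd i (\<lambda>y. B (f y) (g y)) x = B (f x) (pd i g x) + B (pd i f x) (g x)"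
  using pd_eqI[OF bounded_bilinear.FDERIV[OF _ smooth_on_has_derivative smooth_on_has_derivative, OF _ _ xS _ xS]]
  by (auto simp: pd_def)

lemma pd_bounded_linear:
  "bounded_linear L \<Longrightarrow> smooth_on S f \<Longrightarrow> pd i (\<lambda>y. L (f y)) x = L (pd i f x)"
  using pd_eqI[OF bounded_linear.has_derivative[OF _ smooth_on_has_derivative, OF _ _ xS]]
  by (auto simp: pd_def)

lemma pd_diff:
  "smooth_on S f \<Longrightarrow> smooth_on S g \<Longrightarrow> pd i (\<lambda>y. f y - g y) x = pd i f x - pd i g x"
  using pd_eqI[OF has_derivative_diff[OF smooth_on_has_derivative smooth_on_has_derivative, OF _ xS _ xS]]
  by (auto simp: pd_def)

lemma pd_sum:
  "(\<And>k. k \<in> I \<Longrightarrow> smooth_on S (f k)) \<Longrightarrow> pd i (\<lambda>y. \<Sum>k\<in>I. f k y) x = (\<Sum>k\<in>I. pd i (f k) x)"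
  using pd_eqI[OF has_derivative_sum[OF smooth_on_has_derivative, OF _ xS, of I f]]
  by (auto simp: pd_def)

end

subsection \<open>Symmetry of second derivatives\<close>

text \<open>Two applications of the mean value theorem: in direction \<open>u\<close> to the
  increment of \<open>f\<close> along \<open>v\<close>, then in direction \<open>v\<close> to the
  derivative along \<open>u\<close>. The second difference itself is symmetric in \<open>u\<close>
  and \<open>v\<close>.\<close>

lemma second_difference_mean_value:
  fixes f :: "'a::real_normed_vector \<Rightarrow> real"
  assumes f: "smooth_on S f" and S: "ball x d \<subseteq> S" and h: "0 < h" "h * (norm u + norm v) < d"
  obtains y where "norm (y - x) \<le> h * (norm u + norm v)"
    and "f (x + h *\<^sub>R u + h *\<^sub>R v) - f (x + h *\<^sub>R u) - f (x + h *\<^sub>R v) + f x =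
      h * h * frechet_derivative (\<lambda>z. frechet_derivative f (at z) u) (at y) v"
proof -
  define D where "D w g y = frechet_derivative g (at y) w" for w and g :: "'a \<Rightarrow> real" and y
  have nb: "norm (\<xi> *\<^sub>R u + \<eta> *\<^sub>R v) \<le> h * (norm u + norm v)" if "\<bar>\<xi>\<bar> \<le> h" "\<bar>\<eta>\<bar> \<le> h" for \<xi> \<eta>
  proof -
    have "norm (\<xi> *\<^sub>R u + \<eta> *\<^sub>R v) \<le> \<bar>\<xi>\<bar> * norm u + \<bar>\<eta>\<bar> * norm v"
      by (metis norm_triangle_ineq norm_scaleR)
    also have "\<dots> \<le> h * norm u + h * norm v"
      using that by (intro add_mono mult_right_mono) auto
    finally show ?thesis by (simp add: algebra_simps)
  qed
  have inS: "x + \<xi> *\<^sub>R u + \<eta> *\<^sub>R v \<in> S" if "\<bar>\<xi>\<bar> \<le> h" "\<bar>\<eta>\<bar> \<le> h" for \<xi> \<eta>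
    using nb[OF that] h(2) S by (auto simp: dist_norm subset_iff norm_minus_commute add.assoc)
  have line: "((\<lambda>t. g (y + t *\<^sub>R w)) has_real_derivative D w g (y + t *\<^sub>R w)) (at t)"
    if g: "smooth_on S g" and "y + t *\<^sub>R w \<in> S" for g y t w
  proof -
    have "((\<lambda>t. y + t *\<^sub>R w) has_derivative (\<lambda>t. t *\<^sub>R w)) (at t)"
      by (auto intro!: derivative_eq_intros)
    from has_derivative_compose[OF this smooth_on_has_derivative[OF that]]
    have "((\<lambda>t. g (y + t *\<^sub>R w)) has_derivative (\<lambda>r. frechet_derivative g (at (y + t *\<^sub>R w)) (r *\<^sub>R w))) (at t)" .
    moreover have "frechet_derivative g (at (y + t *\<^sub>R w)) (r *\<^sub>R w) = D w g (y + t *\<^sub>R w) * r" for r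
      using linear_frechet_derivative[OF differentiableI[OF smooth_on_has_derivative[OF that]]]
      by (simp add: linear_cmul D_def)
    ultimately show ?thesis by (simp add: has_field_derivative_def)
  qed
  let ?\<phi> = "\<lambda>s. f ((x + h *\<^sub>R v) + s *\<^sub>R u) - f (x + s *\<^sub>R u)"
  have "\<exists>\<xi>>0. \<xi> < h \<and> ?\<phi> h - ?\<phi> 0 = (h - 0) * (D u f ((x + h *\<^sub>R v) + \<xi> *\<^sub>R u) - D u f (x + \<xi> *\<^sub>R u))"
  proof (rule MVT2[OF h(1)])
    fix s assume s: "0 \<le> s" "s \<le> h"
    show "(?\<phi> has_real_derivative D u f ((x + h *\<^sub>R v) + s *\<^sub>R u) - D u f (x + s *\<^sub>R u)) (at s)"
      using s h inS[of s h] inS[of s 0] by (intro DERIV_diff line f) (auto simp: algebra_simps)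
  qed
  then obtain \<xi> where \<xi>: "0 < \<xi>" "\<xi> < h"
    "?\<phi> h - ?\<phi> 0 = h * (D u f ((x + h *\<^sub>R v) + \<xi> *\<^sub>R u) - D u f (x + \<xi> *\<^sub>R u))" by auto
  have "\<exists>\<eta>>0. \<eta> < h \<and> D u f ((x + \<xi> *\<^sub>R u) + h *\<^sub>R v) - D u f ((x + \<xi> *\<^sub>R u) + 0 *\<^sub>R v) =
      (h - 0) * D v (D u f) ((x + \<xi> *\<^sub>R u) + \<eta> *\<^sub>R v)"
  proof (rule MVT2[OF h(1)])
    fix t assume t: "0 \<le> t" "t \<le> h"
    have "smooth_on S (D u f)" unfolding D_def by (intro smooth_intros f)
    then show "((\<lambda>t. D u f ((x + \<xi> *\<^sub>R u) + t *\<^sub>R v)) has_real_derivative D v (D u f) ((x + \<xi> *\<^sub>R u) + t *\<^sub>R v)) (at t)"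
      using t \<xi> inS[of \<xi> t] by (intro line) auto
  qed
  then obtain \<eta> where \<eta>: "0 < \<eta>" "\<eta> < h"
    "D u f ((x + \<xi> *\<^sub>R u) + h *\<^sub>R v) - D u f (x + \<xi> *\<^sub>R u) = h * D v (D u f) ((x + \<xi> *\<^sub>R u) + \<eta> *\<^sub>R v)" by auto
  show ?thesis
  proof (rule that)
    show "norm ((x + \<xi> *\<^sub>R u) + \<eta> *\<^sub>R v - x) \<le> h * (norm u + norm v)"
      using nb[of \<xi> \<eta>] \<xi> \<eta> by (simp add: algebra_simps)
    have "D u f ((x + h *\<^sub>R v) + \<xi> *\<^sub>R u) = D u f ((x + \<xi> *\<^sub>R u) + h *\<^sub>R v)"
      by (simp add: algebra_simps)
    then show "f (x + h *\<^sub>R u + h *\<^sub>R v) - f (x + h *\<^sub>R u) - f (x + h *\<^sub>R v) + f x =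
      h * h * frechet_derivative (\<lambda>z. frechet_derivative f (at z) u) (at ((x + \<xi> *\<^sub>R u) + \<eta> *\<^sub>R v)) v"
      using \<xi>(3) \<eta>(3) by (simp add: D_def[abs_def] algebra_simps)
  qed
qed

text \<open>Near \<open>x\<close> both mixed derivatives take the value of the same second
  difference divided by \<open>h * h\<close>; their continuity at \<open>x\<close> does the
  rest.\<close>

lemma second_derivative_symmetric_real:
  fixes f :: "'a::real_normed_vector \<Rightarrow> real"
  assumes S: "open S" and f: "smooth_on S f" and x: "x \<in> S"
  shows "frechet_derivative (\<lambda>z. frechet_derivative f (at z) u) (at x) v =
    frechet_derivative (\<lambda>z. frechet_derivative f (at z) v) (at x) u"
proof -
  define H where "H u v y = frechet_derivative (\<lambda>z. frechet_derivative f (at z) u) (at y) v" for u v y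
  have cont: "isCont (H u v) x" for u v
    using smooth_on_imp_continuous_on[OF smooth_on_frechet_derivative[OF smooth_on_frechet_derivative[OF f]], of u v]
      x unfolding H_def continuous_on_eq_continuous_at[OF S] by simp
  have "\<bar>H u v x - H v u x\<bar> \<le> e" if e: "e > 0" for e
  proof -
    obtain d where d: "d > 0" "ball x d \<subseteq> S" using S x openE by blast
    obtain d1 where d1: "d1 > 0" "\<And>y. norm (y - x) < d1 \<Longrightarrow> \<bar>H u v y - H u v x\<bar> < e / 2"
      using cont[of u v, unfolded continuous_at_eps_delta, rule_format, of "e/2"] e
      by (auto simp: dist_norm)
    obtain d2 where d2: "d2 > 0" "\<And>y. norm (y - x) < d2 \<Longrightarrow> \<bar>H v u y - H v u x\<bar> < e / 2"
      using cont[of v u, unfolded continuous_at_eps_delta, rule_format, of "e/2"] e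
      by (auto simp: dist_norm)
    define m where "m = min d (min d1 d2)"
    \<comment> \<open>The summand 1 keeps the denominator positive when \<open>u = v = 0\<close> and
      makes \<open>h * (norm u + norm v) < m\<close> strict.\<close>
    define h where "h = m / (norm u + norm v + 1)"
    have m: "m > 0" using d d1 d2 by (simp add: m_def)
    have pos: "norm u + norm v + 1 > 0" by (simp add: add_nonneg_pos)
    have h: "h > 0" using m pos by (simp add: h_def)
    have "h * (norm u + norm v) < h * (norm u + norm v + 1)" using h by simp
    also have "\<dots> = m" using pos by (simp add: h_def)
    finally have hm: "h * (norm u + norm v) < m" .
    from hm have hd: "h * (norm u + norm v) < d" "h * (norm v + norm u) < d" by (simp_all add: m_def add.commute)
    obtain y where y: "norm (y - x) \<le> h * (norm u + norm v)"
      "f (x + h *\<^sub>R u + h *\<^sub>R v) - f (x + h *\<^sub>R u) - f (x + h *\<^sub>R v) + f x = h * h * H u v y"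
      using second_difference_mean_value[OF f d(2) h hd(1)] unfolding H_def by blast
    obtain y' where y': "norm (y' - x) \<le> h * (norm v + norm u)"
      "f (x + h *\<^sub>R v + h *\<^sub>R u) - f (x + h *\<^sub>R v) - f (x + h *\<^sub>R u) + f x = h * h * H v u y'"
      using second_difference_mean_value[OF f d(2) h hd(2)] unfolding H_def by blast
    have "h * h * H u v y = h * h * H v u y'"
      using y(2) y'(2) by (simp add: algebra_simps)
    then have eq: "H u v y = H v u y'" using h by simp
    have "\<bar>H u v y - H u v x\<bar> < e / 2" using d1(2) y(1) hm by (simp add: m_def)
    moreover have "\<bar>H v u y' - H v u x\<bar> < e / 2" using d2(2) y'(1) hm by (simp add: m_def add.commute)
    ultimately show ?thesis using eq by linarith
  qed
  then have "\<bar>H u v x - H v u x\<bar> \<le> 0" by (rule field_le_epsilon) simp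
  then show ?thesis by (simp add: H_def)
qed

lemma inner_eq_everyI:
  fixes a b :: "'a::real_inner"
  assumes "\<And>c. a \<bullet> c = b \<bullet> c"
  shows "a = b"
  using assms[of "a - b"] by (metis inner_diff_left inner_eq_zero_iff right_minus_eq)

lemma second_derivative_symmetric:
  fixes f :: "'a::real_normed_vector \<Rightarrow> 'b::real_inner"
  assumes S: "open S" and f: "smooth_on S f" and x: "x \<in> S"
  shows "frechet_derivative (\<lambda>z. frechet_derivative f (at z) u) (at x) v =
    frechet_derivative (\<lambda>z. frechet_derivative f (at z) v) (at x) u"
proof -
  have comp: "frechet_derivative (\<lambda>z. g z \<bullet> b) (at y) u = frechet_derivative g (at y) u \<bullet> b"
    if "smooth_on S g" "y \<in> S" for g :: "'a \<Rightarrow> 'b" and b y u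
    using fun_cong[OF frechet_derivative_at[OF bounded_linear.has_derivative[OF bounded_linear_inner_left smooth_on_has_derivative[OF that]], of b], of u]
    by simp
  have fb: "smooth_on S (\<lambda>z. f z \<bullet> b)" for b
    by (intro smooth_intros S f)
  have two: "frechet_derivative (\<lambda>z. frechet_derivative (\<lambda>z. f z \<bullet> b) (at z) u) (at x) v =
      frechet_derivative (\<lambda>z. frechet_derivative f (at z) u) (at x) v \<bullet> b" for b u v
  proof -
    have "frechet_derivative (\<lambda>z. frechet_derivative (\<lambda>z. f z \<bullet> b) (at z) u) (at x) =
        frechet_derivative (\<lambda>z. frechet_derivative f (at z) u \<bullet> b) (at x)"
      by (rule frechet_derivative_transform_within_open[OF _ S x comp[OF f]])
        (intro differentiableI[OF smooth_on_has_derivative[OF _ x]] smooth_on_frechet_derivative[OF fb])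
    then show ?thesis using comp[OF smooth_on_frechet_derivative[OF f] x] by simp
  qed
  show ?thesis
    by (rule inner_eq_everyI) (simp add: two[symmetric] second_derivative_symmetric_real[OF S fb x, of _ u v])
qed

lemma pd_commute:
  fixes f :: "real^'n \<Rightarrow> 'b::real_inner"
  shows "open S \<Longrightarrow> x \<in> S \<Longrightarrow> smooth_on S f \<Longrightarrow> pd i (pd j f) x = pd j (pd i f) x"
  using second_derivative_symmetric[of S f x] unfolding pd_def[abs_def] by blast

section \<open>Linear algebra over the quaternions\<close>

lemma DIM_quat: "DIM(quat) = 4"
  by (simp add: Basis_quat_def)

lemma qcnj_sel [simp]:
  "qre (qcnj h) = qre h" "qi (qcnj h) = - qi h" "qj (qcnj h) = - qj h" "qk (qcnj h) = - qk h"
  by (simp_all add: qcnj_def)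

lemma unit_j_sel [simp]: "qre unit_j = 0" "qi unit_j = 0" "qj unit_j = 1" "qk unit_j = 0"
  by (simp_all add: unit_j_def)

lemma quat_of_real_sel [simp]:
  "qre (of_real r) = r" "qi (of_real r) = 0" "qj (of_real r) = 0" "qk (of_real r) = 0"
  by (simp_all add: of_real_def)

lemma quat_of_nat_sel [simp]:
  "qre (of_nat n) = real n" "qi (of_nat n) = 0" "qj (of_nat n) = 0" "qk (of_nat n) = 0"
  using quat_of_real_sel[of "real n"] by simp_all

lemma qcnj_simps [simp]:
  "qcnj (a * b) = qcnj b * qcnj a" "qcnj (a + b) = qcnj a + qcnj b" "qcnj (a - b) = qcnj a - qcnj b"
  "qcnj (- a) = - qcnj a" "qcnj (qcnj a) = a" "qcnj 0 = 0" "qcnj 1 = 1" "qcnj (of_real r) = of_real r"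
  "qcnj (r *\<^sub>R a) = r *\<^sub>R qcnj a" "qcnj unit_j = - unit_j"
  by (simp_all add: quat_eq_iff algebra_simps)

lemma qcnj_eq_0_iff [simp]: "qcnj a = 0 \<longleftrightarrow> a = 0"
  by (simp add: quat_eq_iff)

lemma quat_inner_self_mult: "(a * b) \<bullet> (a * b) = (a \<bullet> a) * (b \<bullet> (b :: quat))"
  by (simp add: inner_quat_def algebra_simps)

lemma norm_quat_mult: "norm (a * b) = norm a * norm (b :: quat)"
  by (simp add: norm_eq_sqrt_inner quat_inner_self_mult real_sqrt_mult)

lemma inner_qcnj: "qcnj a \<bullet> qcnj b = a \<bullet> b" "qcnj a \<bullet> b = a \<bullet> qcnj b"
  by (simp_all add: inner_quat_def)

lemma norm_qcnj: "norm (qcnj a) = norm a"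
  by (simp add: norm_eq_sqrt_inner inner_qcnj)

lemma one_inner: "(1 :: quat) \<bullet> 1 = 1" and unit_j_inner: "unit_j \<bullet> unit_j = 1"
  by (simp_all add: inner_quat_def)

lemma unit_j_mult_inner: "(unit_j * a) \<bullet> (unit_j * a) = a \<bullet> a"
  by (simp add: inner_quat_def)

lemma norm_of_nat_quat: "norm (of_nat n :: quat) = real n"
  by (simp add: norm_eq_sqrt_inner inner_quat_def)

lemma norm_unit_j: "norm unit_j = 1"
  by (simp add: norm_eq_sqrt_inner inner_quat_def)

lemma quat_inner_mult_left: "(a * b) \<bullet> c = b \<bullet> (qcnj a * c)" "c \<bullet> (a * b) = (qcnj a * c) \<bullet> b"
  by (simp_all add: inner_quat_def algebra_simps)

lemma quat_inner_mult_right: "(a * b) \<bullet> c = a \<bullet> (c * qcnj b)"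
  by (simp_all add: inner_quat_def algebra_simps)

lemma quat_inner_eq_qre: "a \<bullet> b = qre (qcnj a * b)"
  by (simp add: inner_quat_def)

lemma qcnj_mult_self: "qcnj a * a = of_real (a \<bullet> a)" "a * qcnj a = of_real (a \<bullet> a)"
  by (simp_all add: quat_eq_iff inner_quat_def algebra_simps)

lemma quat_real_iff: "a = of_real (qre a) \<longleftrightarrow> qcnj a = a"
  by (auto simp: quat_eq_iff)

lemma quat_imaginary_iff: "qre a = 0 \<longleftrightarrow> qcnj a = - a"
  by (auto simp: quat_eq_iff)

text \<open>The quaternionic Hermitian form on the right module H^3, conjugate-linear in the first
  argument. Its real part is the Euclidean inner product.\<close>

definition hdot :: "quat3 \<Rightarrow> quat3 \<Rightarrow> quat" where
  "hdot u w = qcnj (fst u) * fst w + qcnj (fst (snd u)) * fst (snd w) + qcnj (snd (snd u)) * snd (snd w)"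

lemma rmult_eq: "rmult u h = (fst u * h, fst (snd u) * h, snd (snd u) * h)"
  by (cases u) auto

lemma circle_velocity_eq: "circle_velocity p q u =
    (real q *\<^sub>R (unit_j * fst u), real p *\<^sub>R (unit_j * fst (snd u)), real p *\<^sub>R (unit_j * snd (snd u)))"
  by (cases u) auto

lemma inner_quat3: "(u :: quat3) \<bullet> w = fst u \<bullet> fst w + fst (snd u) \<bullet> fst (snd w) + snd (snd u) \<bullet> snd (snd w)"
  by (simp add: inner_prod_def)

lemma inner_eq_qre_hdot: "u \<bullet> w = qre (hdot u w)"
  by (simp add: inner_quat3 hdot_def quat_inner_eq_qre)

lemma hdot_add: "hdot u (v + w) = hdot u v + hdot u w" "hdot (u + v) w = hdot u w + hdot v w"
  by (simp_all add: hdot_def algebra_simps)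

lemma hdot_diff: "hdot u (v - w) = hdot u v - hdot u w" "hdot (u - v) w = hdot u w - hdot v w"
  by (simp_all add: hdot_def algebra_simps)

lemma hdot_minus: "hdot u (- w) = - hdot u w" "hdot (- u) w = - hdot u w"
  by (simp_all add: hdot_def algebra_simps)

lemma hdot_scaleR: "hdot u (r *\<^sub>R w) = r *\<^sub>R hdot u w" "hdot (r *\<^sub>R u) w = r *\<^sub>R hdot u w"
  by (simp_all add: hdot_def algebra_simps)

lemma hdot_zero: "hdot u 0 = 0" "hdot 0 u = 0"
  by (simp_all add: hdot_def)

lemma hdot_rmult: "hdot u (rmult w h) = hdot u w * h" "hdot (rmult u h) w = qcnj h * hdot u w"
  by (simp_all add: hdot_def rmult_eq algebra_simps)

lemmas hdot_simps = hdot_add hdot_diff hdot_minus hdot_scaleR hdot_rmult hdot_zero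

lemma hdot_commute: "hdot w u = qcnj (hdot u w)"
  by (simp add: hdot_def)

lemma hdot_self: "hdot u u = of_real (u \<bullet> u)"
  by (simp add: hdot_def inner_quat3 qcnj_mult_self)

lemma rmult_add: "rmult (u + v) h = rmult u h + rmult v h" "rmult u (h + k) = rmult u h + rmult u k"
  by (simp_all add: rmult_eq algebra_simps)

lemma rmult_diff: "rmult (u - v) h = rmult u h - rmult v h" "rmult u (h - k) = rmult u h - rmult u k"
  by (simp_all add: rmult_eq algebra_simps)

lemma rmult_minus: "rmult (- u) h = - rmult u h" "rmult u (- h) = - rmult u h"
  by (simp_all add: rmult_eq)

lemma rmult_scaleR: "rmult (r *\<^sub>R u) h = r *\<^sub>R rmult u h" "rmult u (r *\<^sub>R h) = r *\<^sub>R rmult u h"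
  by (simp_all add: rmult_eq)

lemma rmult_rmult: "rmult (rmult u a) b = rmult u (a * b)"
  by (simp add: rmult_eq mult.assoc)

lemma rmult_0: "rmult u 0 = 0" "rmult 0 h = 0"
  by (simp_all add: rmult_eq zero_prod_def)

lemma rmult_of_real: "rmult u (of_real r) = r *\<^sub>R u" "rmult u 1 = u"
  by (cases u; simp add: rmult_eq of_real_def)+

lemmas rmult_simps = rmult_add rmult_diff rmult_minus rmult_scaleR rmult_rmult rmult_0 rmult_of_real

lemma inner_rmult_left: "rmult u h \<bullet> w = h \<bullet> hdot u w"
  by (simp add: inner_eq_qre_hdot hdot_rmult quat_inner_eq_qre)

lemma inner_rmult_right: "w \<bullet> rmult u h = h \<bullet> hdot u w"
  by (metis inner_commute inner_rmult_left)

lemma bounded_linear_circle_velocity: "bounded_linear (circle_velocity p q)"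
  by (rule linear_conv_bounded_linear[THEN iffD1, OF linearI]) (simp_all add: circle_velocity_eq algebra_simps)

lemmas circle_velocity_linear =
  linear_simps[OF bounded_linear_circle_velocity]

lemma circle_velocity_rmult: "circle_velocity p q (rmult u h) = rmult (circle_velocity p q u) h"
  by (simp add: circle_velocity_eq rmult_eq mult.assoc)

text \<open>Skew-Hermitian over the quaternions, because \<open>unit_j\<close> is imaginary and acts
  from the left with real weights.\<close>

lemma hdot_circle_velocity: "hdot (circle_velocity p q u) w = - hdot u (circle_velocity p q w)"
  by (simp add: circle_velocity_eq hdot_def algebra_simps)

lemma inner_circle_velocity: "circle_velocity p q u \<bullet> w = - (u \<bullet> circle_velocity p q w)"
  by (simp add: inner_eq_qre_hdot hdot_circle_velocity)

lemma bounded_bilinear_hdot: "bounded_bilinear hdot"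
  unfolding bilinear_conv_bounded_bilinear[symmetric] bilinear_def
  by (intro conjI allI linearI) (simp_all add: hdot_simps)

lemma bounded_bilinear_rmult: "bounded_bilinear rmult"
  unfolding bilinear_conv_bounded_bilinear[symmetric] bilinear_def
  by (intro conjI allI linearI) (simp_all add: rmult_simps)

text \<open>Turns the moment equation into quaternionic orthogonality of a point and its
  velocity.\<close>

lemma moment_eq_hdot: "moment p q u = hdot u (circle_velocity p q u)"
  by (cases u) (simp add: hdot_def quat_eq_iff algebra_simps)

lemma sphere11_iff: "u \<in> sphere11 \<longleftrightarrow> u \<bullet> u = 1"
  by (cases u) (simp add: sphere11_def power2_norm_eq_inner inner_prod_def add.assoc)

section \<open>The zero level of the moment map\<close>

definition level :: "nat \<Rightarrow> nat \<Rightarrow> quat3 set" where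
  "level p q = {u \<in> sphere11. moment p q u = 0}"

text \<open>By Pythagoras; it turns the closest points in the definitions of the horizontal lifts
  into explicit orthogonal projections.\<close>

lemma closest_point_subspace:
  fixes S :: "'a::euclidean_space set"
  assumes "subspace S" "y \<in> S" "\<And>z. z \<in> S \<Longrightarrow> (w - y) \<bullet> z = 0"
  shows "closest_point S w = y"
proof -
  have "dist w y \<le> dist w z" if "z \<in> S" for z
  proof -
    have "y - z \<in> S" using assms that by (simp add: subspace_diff)
    then have "(norm (w - z))\<^sup>2 = (norm (w - y))\<^sup>2 + (norm (y - z))\<^sup>2"
      using assms(3)[of "y - z"] norm_add_Pythagorean[of "w - y" "y - z"] by (simp add: orthogonal_def)
    then have "(norm (w - y))\<^sup>2 \<le> (norm (w - z))\<^sup>2" by simp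
    then show ?thesis by (simp add: dist_norm)
  qed
  then show ?thesis
    using closest_point_unique[of S y w] assms(1,2) subspace_imp_convex closed_subspace by metis
qed

locale level_point =
  fixes p q :: nat and u :: quat3
  assumes pq: "p > 0" "q > 0" and u: "u \<in> level p q"
begin

abbreviation "D \<equiv> circle_velocity p q"

definition "nu2 = D u \<bullet> D u"

lemma uu: "u \<bullet> u = 1" "hdot u u = 1"
  using u by (simp_all add: level_def sphere11_iff hdot_self)

lemma uDu: "hdot u (D u) = 0" "hdot (D u) u = 0"
  using u hdot_commute[of u "D u"] by (simp_all add: level_def moment_eq_hdot)

lemma DuDu: "hdot (D u) (D u) = of_real nu2"
  by (simp add: hdot_self nu2_def)

text \<open>Left multiplication by \<open>unit_j\<close> preserves norms, so only the weights
  matter. Consequently \<open>lam\<close> too depends on \<open>u\<close> only through the norm of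
  \<open>fst u\<close>.\<close>

lemma nu2_eq: "nu2 = (real p)\<^sup>2 + ((real q)\<^sup>2 - (real p)\<^sup>2) * (fst u \<bullet> fst u)"
proof -
  have r: "fst (snd u) \<bullet> fst (snd u) + snd (snd u) \<bullet> snd (snd u) = 1 - fst u \<bullet> fst u"
    using uu(1) by (simp add: inner_quat3)
  have "nu2 = (real q)\<^sup>2 * (fst u \<bullet> fst u)
      + (real p)\<^sup>2 * (fst (snd u) \<bullet> fst (snd u) + snd (snd u) \<bullet> snd (snd u))"
    by (simp add: nu2_def circle_velocity_eq inner_quat3 unit_j_mult_inner power2_eq_square algebra_simps)
  then show ?thesis unfolding r by (simp add: algebra_simps)
qed

text \<open>The summands of the moment map have norms q|u_0|^2, p|u_1|^2 and p|u_2|^2; if their sum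
  vanishes, the triangle inequality bounds the first by the other two.\<close>

lemma level_bound: "real q * (fst u \<bullet> fst u) \<le> real p * (1 - fst u \<bullet> fst u)"
proof -
  have n: "norm (qcnj a * unit_j * a) = a \<bullet> a" for a
    by (simp add: norm_quat_mult norm_qcnj norm_unit_j dot_square_norm power2_eq_square)
  obtain u0 u1 u2 where u_eq: "u = (u0, u1, u2)" by (cases u)
  have "of_nat q * (qcnj u0 * unit_j * u0) =
      - (of_nat p * (qcnj u1 * unit_j * u1) + of_nat p * (qcnj u2 * unit_j * u2))"
    using u unfolding eq_neg_iff_add_eq_0 by (simp add: level_def u_eq add.assoc)
  then have "norm (of_nat q * (qcnj u0 * unit_j * u0)) =
      norm (of_nat p * (qcnj u1 * unit_j * u1) + of_nat p * (qcnj u2 * unit_j * u2))"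
    by (metis norm_minus_cancel)
  also have "\<dots> \<le> norm (of_nat p * (qcnj u1 * unit_j * u1)) + norm (of_nat p * (qcnj u2 * unit_j * u2))"
    by (rule norm_triangle_ineq)
  finally have "real q * (u0 \<bullet> u0) \<le> real p * (u1 \<bullet> u1) + real p * (u2 \<bullet> u2)"
    by (simp add: norm_quat_mult[of "of_nat _"] n norm_of_nat_quat del: qcnj_simps)
  then have "real q * (u0 \<bullet> u0) \<le> real p * (u1 \<bullet> u1 + u2 \<bullet> u2)" by (simp add: distrib_left)
  moreover have "u1 \<bullet> u1 + u2 \<bullet> u2 = 1 - u0 \<bullet> u0" using uu(1) by (simp add: u_eq inner_prod_def)
  ultimately show ?thesis by (simp add: u_eq)
qed

lemma nu2_pos: "nu2 > 0"
proof -
  have r: "0 \<le> fst u \<bullet> fst u" "fst u \<bullet> fst u \<le> 1"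
    using uu(1) inner_ge_zero[of "fst (snd u)"] inner_ge_zero[of "snd (snd u)"] inner_ge_zero[of "fst u"]
    unfolding inner_quat3 by linarith+
  have "nu2 = (real p)\<^sup>2 * (1 - fst u \<bullet> fst u) + (real q)\<^sup>2 * (fst u \<bullet> fst u)"
    by (simp add: nu2_eq algebra_simps)
  moreover have "(real p)\<^sup>2 * (1 - fst u \<bullet> fst u) + (real q)\<^sup>2 * (fst u \<bullet> fst u) > 0"
  proof (cases "fst u \<bullet> fst u = 0")
    case False
    then have "fst u \<bullet> fst u > 0" using r(1) by linarith
    then show ?thesis using r(2) pq by (intro add_nonneg_pos mult_pos_pos mult_nonneg_nonneg) auto
  qed (use pq in simp)
  ultimately show ?thesis by simp
qed

lemma hp_horizontal_eq: "hp_horizontal u w = w - rmult u (hdot u w - of_real (u \<bullet> w))"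
  unfolding hp_horizontal_def
proof (rule closest_point_subspace)
  let ?S = "{rmult u a | a. qre a = 0}"
  show "subspace (orthogonal_comp ?S)" by (rule subspace_orthogonal_comp)
  show "w - rmult u (hdot u w - of_real (u \<bullet> w)) \<in> orthogonal_comp ?S"
    by (auto simp: orthogonal_comp_def orthogonal_def inner_rmult_left hdot_simps uu)
      (simp add: inner_quat_def inner_eq_qre_hdot)
  fix z assume "z \<in> orthogonal_comp ?S"
  moreover have "qre (hdot u w - of_real (u \<bullet> w)) = 0" by (simp add: inner_eq_qre_hdot)
  ultimately have "rmult u (hdot u w - of_real (u \<bullet> w)) \<bullet> z = 0"
    unfolding orthogonal_comp_def orthogonal_def by blast
  then show "(w - (w - rmult u (hdot u w - of_real (u \<bullet> w)))) \<bullet> z = 0"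
    by simp
qed

lemma hp_horizontal_velocity: "hp_horizontal u (D u) = D u"
  by (simp add: hp_horizontal_eq inner_eq_qre_hdot uDu rmult_0)

lemma orbifold_horizontal_eq:
  "orbifold_horizontal p q u w =
    w - rmult u (hdot u w - of_real (u \<bullet> w)) - (D u \<bullet> w / nu2) *\<^sub>R D u"
  unfolding orbifold_horizontal_def hp_horizontal_velocity
proof (rule closest_point_subspace)
  show "subspace (orthogonal_comp {D u})" by (rule subspace_orthogonal_comp)
  have "D u \<bullet> hp_horizontal u w = D u \<bullet> w"
    by (simp add: hp_horizontal_eq inner_diff_right inner_rmult_right uDu)
  then show "w - rmult u (hdot u w - of_real (u \<bullet> w)) - (D u \<bullet> w / nu2) *\<^sub>R D u \<in> orthogonal_comp {D u}"
    using nu2_pos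
    by (simp add: orthogonal_comp_def orthogonal_def hp_horizontal_eq[symmetric] inner_diff_right nu2_def[symmetric])
  fix z assume "z \<in> orthogonal_comp {D u}"
  then show "(hp_horizontal u w - (w - rmult u (hdot u w - of_real (u \<bullet> w)) - (D u \<bullet> w / nu2) *\<^sub>R D u)) \<bullet> z = 0"
    by (simp add: orthogonal_comp_def orthogonal_def hp_horizontal_eq)
qed

definition horiz :: "quat3 set" where
  "horiz = {w. hdot u w = 0 \<and> hdot (D u) w = 0}"

lemma horizD: "w \<in> horiz \<Longrightarrow> hdot u w = 0" "w \<in> horiz \<Longrightarrow> hdot (D u) w = 0"
    "w \<in> horiz \<Longrightarrow> hdot w u = 0" "w \<in> horiz \<Longrightarrow> hdot w (D u) = 0"
    "w \<in> horiz \<Longrightarrow> hdot u (D w) = 0" "w \<in> horiz \<Longrightarrow> hdot (D w) u = 0"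
  using hdot_commute[of w u] hdot_commute[of w "D u"] hdot_circle_velocity[of p q u w] hdot_circle_velocity[of p q w u]
  by (auto simp: horiz_def)

text \<open>The hypotheses are the linearized sphere and moment equations. They make the component
  along \<open>u\<close> imaginary and the one along \<open>D u\<close> real, which is precisely
  what the projection removes.\<close>

lemma orbifold_horizontal_in_horiz:
  assumes "u \<bullet> w = 0" "hdot (D u) w = of_real (D u \<bullet> w)"
  shows "orbifold_horizontal p q u w \<in> horiz"
  using nu2_pos
  by (simp add: horiz_def orbifold_horizontal_eq hdot_simps assms uu uDu DuDu of_real_def)

end

section \<open>Quaternionic orthogonal frames at a point of the zero level\<close>

locale level_frame = level_point +
  fixes w :: quat3
  assumes w: "w \<in> horiz" "w \<bullet> w = 1"
begin

lemma ww: "hdot w w = 1" using w by (simp add: hdot_self)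

text \<open>The three vectors are pairwise orthogonal for \<open>hdot\<close>, so the coordinate map
  \<phi> is injective, and a linear injection of \<open>quat3\<close> into itself is onto.\<close>

lemma decomposition:
  "Z = rmult u (hdot u Z) + rmult (D u) ((1 / nu2) *\<^sub>R hdot (D u) Z) + rmult w (hdot w Z)"
proof -
  define \<phi> where "\<phi> v = rmult u (fst v) + rmult (D u) (fst (snd v)) + rmult w (snd (snd v))" for v :: quat3
  have h: "hdot u (\<phi> v) = fst v" "hdot (D u) (\<phi> v) = nu2 *\<^sub>R fst (snd v)" "hdot w (\<phi> v) = snd (snd v)" for v
    by (simp_all add: \<phi>_def hdot_simps uu uDu DuDu horizD[OF w(1)] ww) (simp add: of_real_def)
  have lin: "linear \<phi>"
    by (rule linearI) (simp_all add: \<phi>_def rmult_simps algebra_simps)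
  have "inj \<phi>"
    unfolding linear_injective_0[OF lin]
  proof (intro allI impI)
    fix v assume "\<phi> v = 0"
    then have "fst v = 0" "fst (snd v) = 0" "snd (snd v) = 0"
      using h[of v] nu2_pos by (simp_all add: hdot_zero)
    then show "v = 0" by (simp add: prod_eq_iff)
  qed
  then have "surj \<phi>" using linear_injective_imp_surjective[OF lin] by simp
  then obtain v where v: "Z = \<phi> v" by (metis surjD)
  show ?thesis
    using nu2_pos by (simp add: v h) (simp add: \<phi>_def)
qed

lemma horiz_decomposition: "Z \<in> horiz \<Longrightarrow> Z = rmult w (hdot w Z)"
  using decomposition[of Z] by (simp add: horizD rmult_0)

lemma parseval:
  "Z \<bullet> Z = hdot u Z \<bullet> hdot u Z + (hdot (D u) Z \<bullet> hdot (D u) Z) / nu2 + hdot w Z \<bullet> hdot w Z"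
proof -
  have "Z \<bullet> Z = Z \<bullet> (rmult u (hdot u Z) + rmult (D u) ((1 / nu2) *\<^sub>R hdot (D u) Z) + rmult w (hdot w Z))"
    using decomposition[of Z] by simp
  also have "\<dots> = hdot u Z \<bullet> hdot u Z + (hdot (D u) Z \<bullet> hdot (D u) Z) / nu2 + hdot w Z \<bullet> hdot w Z"
    by (simp add: inner_add_right inner_rmult_right)
  finally show ?thesis .
qed

definition "a = hdot w (D w)"

lemma qre_a: "qre a = 0"
proof -
  have "qcnj a = hdot (D w) w" by (simp add: a_def hdot_commute[of "D w" w])
  also have "\<dots> = - a" by (simp add: a_def hdot_circle_velocity)
  finally show ?thesis by (simp add: quat_imaginary_iff)
qed

lemma hdot_Dw: "hdot (D w) w = - a"
  by (simp add: a_def hdot_circle_velocity)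

text \<open>The two Parseval identities used here are those of \<open>(1, 0, 0)\<close>, which gives the norm of the first
  entry of \<open>w\<close>, and of \<open>D w\<close>.\<close>

lemma a_sq: "a \<bullet> a = (real p)^4 * (real q)\<^sup>2 / nu2\<^sup>2"
proof -
  define r where "r = fst u \<bullet> fst u"
  define m where "m = fst w \<bullet> fst w"
  define P where "P = (real p)\<^sup>2"
  define Q where "Q = (real q)\<^sup>2"
  have nu: "nu2 = P + (Q - P) * r" by (simp add: nu2_eq r_def P_def Q_def)
  have 1: "1 = r + Q * r / nu2 + m"
    using parseval[of "(1, 0, 0)"]
    by (simp add: hdot_def circle_velocity_eq inner_quat3 inner_qcnj r_def m_def Q_def power2_eq_square one_inner
        quat_inner_self_mult unit_j_inner)
  \<comment> \<open>The entries carry the weights \<open>Q\<close>, \<open>P\<close>,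
    \<open>P\<close>; since \<open>hdot u w = 0\<close>, only the excess \<open>Q - P\<close> in the
    first entry will survive.\<close>
  have "hdot (D u) (D w) = P *\<^sub>R hdot u w + (Q - P) *\<^sub>R (qcnj (fst u) * fst w)"
    by (simp add: hdot_def circle_velocity_eq P_def Q_def power2_eq_square quat_eq_iff) (simp add: algebra_simps)
  then have "hdot (D u) (D w) \<bullet> hdot (D u) (D w) = (Q - P)\<^sup>2 * (r * m)"
    by (simp add: horizD[OF w(1)] quat_inner_self_mult inner_qcnj r_def m_def power2_eq_square)
  moreover have "D w \<bullet> D w = P + (Q - P) * m"
  proof -
    have r: "fst (snd w) \<bullet> fst (snd w) + snd (snd w) \<bullet> snd (snd w) = 1 - m"
      using w(2) by (simp add: inner_quat3 m_def)
    have "D w \<bullet> D w = Q * m + P * (fst (snd w) \<bullet> fst (snd w) + snd (snd w) \<bullet> snd (snd w))"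
      by (simp add: circle_velocity_eq inner_quat3 unit_j_mult_inner m_def P_def Q_def power2_eq_square algebra_simps)
    then show ?thesis unfolding r by (simp add: algebra_simps)
  qed
  ultimately have 2: "P + (Q - P) * m = (Q - P)\<^sup>2 * (r * m) / nu2 + a \<bullet> a"
    using parseval[of "D w"] by (simp add: horizD[OF w(1)] a_def)
  have m: "m * nu2 = nu2 - r * nu2 - Q * r" using 1 nu2_pos by (simp add: field_simps)
  have "(a \<bullet> a) * nu2 = P * nu2 + (Q - P) * (m * nu2) - (Q - P)\<^sup>2 * (r * m)"
    using 2 nu2_pos by (simp add: field_simps)
  \<comment> \<open>The second factor \<open>nu2\<close> allows \<open>m\<close> to be eliminated
    from both terms, as only \<open>m * nu2\<close> is known without a quotient.\<close>
  then have "(a \<bullet> a) * nu2 * nu2 = (P * nu2 + (Q - P) * (m * nu2) - (Q - P)\<^sup>2 * (r * m)) * nu2"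
    by simp
  also have "\<dots> = P * nu2\<^sup>2 + (Q - P) * (m * nu2) * nu2 - (Q - P)\<^sup>2 * r * (m * nu2)"
    by (simp add: algebra_simps power2_eq_square[of nu2])
  also have "\<dots> = P\<^sup>2 * Q"
    unfolding m unfolding nu by (simp add: algebra_simps power2_eq_square)
  finally show ?thesis
    using nu2_pos by (simp add: P_def Q_def eq_divide_eq power2_eq_square power4_eq_xxxx mult.assoc)
qed

end

section \<open>The curvature form of the quotient\<close>

text \<open>The contribution of the projective plane: in the coordinates \<open>x\<close>,
  \<open>y\<close> of two vectors of a quaternionic line, constant curvature 4.\<close>

lemma quat_curvature_identity_1:
  "- ((y * (qcnj x * y - qcnj y * x)) \<bullet> x) + (x * (qcnj y * y)) \<bullet> x - (y * (qcnj x * y)) \<bullet> x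
    = 4 * ((x \<bullet> x) * (y \<bullet> y) - (x \<bullet> y)\<^sup>2)"
  by (simp add: inner_quat_def power2_eq_square algebra_simps)

context
  fixes a x y m :: quat
  assumes a: "qre a = 0" and m_def: "m = y * qcnj x"
begin

text \<open>Everything depends on \<open>x\<close> and \<open>y\<close> through \<open>m\<close>
  alone: their Gram determinant is the squared norm of the imaginary part of \<open>m\<close>, and
  the imaginary \<open>a\<close> pairs only with that part.\<close>

lemma quat_product_reduction:
  "(a * x) \<bullet> y = a \<bullet> m" "(a * y) \<bullet> x = - (a \<bullet> m)" "x \<bullet> y = qre m" "(x \<bullet> x) * (y \<bullet> y) = m \<bullet> m"
proof -
  show "(a * x) \<bullet> y = a \<bullet> m" by (simp add: m_def quat_inner_mult_right)
  have "(a * y) \<bullet> x = a \<bullet> qcnj m" by (simp add: m_def quat_inner_mult_right)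
  also have "\<dots> = - (a \<bullet> m)" using a by (simp add: inner_quat_def)
  finally show "(a * y) \<bullet> x = - (a \<bullet> m)" .
  show "x \<bullet> y = qre m" by (simp add: m_def inner_quat_def)
  show "(x \<bullet> x) * (y \<bullet> y) = m \<bullet> m" by (simp add: m_def quat_inner_self_mult inner_qcnj)
qed

text \<open>The contribution of the circle action. Moving the outer factors across the inner product
  leaves an identity in \<open>a\<close> and \<open>m\<close>, checked in coordinates.\<close>

lemma quat_curvature_identity_2:
  "- 2 * ((a * x) \<bullet> y) * ((a * y) \<bullet> x) + (a * (x * (- (qcnj y * a * y)))) \<bullet> x - (a * (y * (- (qcnj x * a * y)))) \<bullet> x
    = 6 * ((a * x) \<bullet> y)\<^sup>2 - 2 * (a \<bullet> a) * ((x \<bullet> x) * (y \<bullet> y) - (x \<bullet> y)\<^sup>2)"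
proof -
  have "(a * (x * (- (qcnj y * a * y)))) \<bullet> x = - ((a * (x * qcnj y) * a * y) \<bullet> x)"
    by (simp add: mult.assoc)
  also have "\<dots> = - ((a * qcnj m * a) \<bullet> qcnj m)"
    by (subst quat_inner_mult_right) (simp add: m_def)
  finally have 1: "(a * (x * (- (qcnj y * a * y)))) \<bullet> x = - ((a * qcnj m * a) \<bullet> qcnj m)" .
  have "(a * (y * (- (qcnj x * a * y)))) \<bullet> x = - ((a * (y * qcnj x) * a * y) \<bullet> x)"
    by (simp add: mult.assoc)
  also have "\<dots> = - ((a * m * a) \<bullet> qcnj m)"
    by (subst quat_inner_mult_right) (simp add: m_def)
  finally have 2: "(a * (y * (- (qcnj x * a * y)))) \<bullet> x = - ((a * m * a) \<bullet> qcnj m)" .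
  show ?thesis
    unfolding 1 2 quat_product_reduction using a
    by (simp add: inner_quat_def power2_eq_square algebra_simps)
qed

text \<open>Lagrange's identity: the defect is the squared norm of the cross product of
  \<open>a\<close> with the imaginary part of \<open>m\<close>.\<close>

lemma quat_imaginary_cauchy_schwarz:
  "((a * x) \<bullet> y)\<^sup>2 \<le> (a \<bullet> a) * ((x \<bullet> x) * (y \<bullet> y) - (x \<bullet> y)\<^sup>2)"
proof -
  have "(a \<bullet> a) * (m \<bullet> m - (qre m)\<^sup>2) - (a \<bullet> m)\<^sup>2 =
      (qi a * qj m - qj a * qi m)\<^sup>2 + (qi a * qk m - qk a * qi m)\<^sup>2 + (qj a * qk m - qk a * qj m)\<^sup>2"
    using a by (simp add: inner_quat_def power2_eq_square algebra_simps)
  then have "0 \<le> (a \<bullet> a) * (m \<bullet> m - (qre m)\<^sup>2) - (a \<bullet> m)\<^sup>2" by simp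
  then show ?thesis unfolding quat_product_reduction by simp
qed

end

context level_point
begin

text \<open>The pairing of R(X,Y)Z with U for horizontal vectors. The first two terms are the
  curvatures of the Hopf fibration and of the circle orbits; the others come from the components of
  the corrected derivative along \<open>u\<close> and \<open>D u\<close>.\<close>

definition curv :: "quat3 \<Rightarrow> quat3 \<Rightarrow> quat3 \<Rightarrow> quat3 \<Rightarrow> real" where
  "curv X Y Z U = - (rmult Z (hdot X Y - hdot Y X) \<bullet> U) - 2 * (D X \<bullet> Y) / nu2 * (D Z \<bullet> U)
     + rmult X (hdot Y Z) \<bullet> U - rmult Y (hdot X Z) \<bullet> U
     + (rmult (D X) (hdot (D Y) Z) \<bullet> U - rmult (D Y) (hdot (D X) Z) \<bullet> U) / nu2"

definition "lam = (real p)^4 * (real q)\<^sup>2 / nu2^3"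

end

definition gram :: "'a::real_inner \<Rightarrow> 'a \<Rightarrow> real" where
  "gram X Y = (X \<bullet> X) * (Y \<bullet> Y) - (X \<bullet> Y)\<^sup>2"

context level_frame
begin

lemma lam_eq: "lam = (a \<bullet> a) / nu2"
  by (simp add: lam_def a_sq power2_eq_square power3_eq_cube)

text \<open>Coordinates on the horizontal line: \<open>rmult w\<close> is isometric and turns the
  compression of \<open>D\<close> into left multiplication by \<open>a\<close>.\<close>

lemma rmult_w_hdot:
  "hdot (rmult w x) (rmult w y) = qcnj x * y" "rmult w x \<bullet> rmult w y = x \<bullet> y"
  "hdot (D (rmult w x)) (rmult w y) = - (qcnj x * a * y)" "D (rmult w x) \<bullet> rmult w y = (a * x) \<bullet> y"
proof -
  show *: "hdot (rmult w x) (rmult w y) = qcnj x * y"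
    by (simp add: hdot_rmult ww)
  then show "rmult w x \<bullet> rmult w y = x \<bullet> y"
    by (simp add: inner_eq_qre_hdot quat_inner_eq_qre)
  show **: "hdot (D (rmult w x)) (rmult w y) = - (qcnj x * a * y)"
    by (simp add: hdot_rmult circle_velocity_rmult hdot_Dw mult.assoc)
  then show "D (rmult w x) \<bullet> rmult w y = (a * x) \<bullet> y"
    using qre_a by (simp add: inner_eq_qre_hdot, simp add: inner_quat_def algebra_simps)
qed

lemma curv_formula:
  assumes "X \<in> horiz" "Y \<in> horiz"
  shows "curv X Y Y X = (4 - 2 * lam) * gram X Y + 6 * (D X \<bullet> Y)\<^sup>2 / nu2"
    and "(D X \<bullet> Y)\<^sup>2 / nu2 \<le> lam * gram X Y"
proof -
  obtain x y where x: "X = rmult w x" and y: "Y = rmult w y"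
    using horiz_decomposition assms by metis
  have Drm: "rmult (D (rmult w b)) h \<bullet> rmult w c = (a * (b * h)) \<bullet> c" for b c h
    using rmult_w_hdot(4)[of "b * h" c] by (simp add: circle_velocity_rmult rmult_rmult)
  have "curv X Y Y X = (- ((y * (qcnj x * y - qcnj y * x)) \<bullet> x) + (x * (qcnj y * y)) \<bullet> x - (y * (qcnj x * y)) \<bullet> x)
    + (- 2 * ((a * x) \<bullet> y) * ((a * y) \<bullet> x) + (a * (x * (- (qcnj y * a * y)))) \<bullet> x
        - (a * (y * (- (qcnj x * a * y)))) \<bullet> x) / nu2"
    unfolding curv_def x y rmult_w_hdot Drm rmult_rmult by (simp add: diff_divide_distrib add_divide_distrib)
  also have "\<dots> = 4 * gram x y + (6 * ((a * x) \<bullet> y)\<^sup>2 - 2 * (a \<bullet> a) * gram x y) / nu2"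
    unfolding quat_curvature_identity_1 quat_curvature_identity_2[OF qre_a refl] gram_def ..
  also have "\<dots> = (4 - 2 * lam) * gram x y + 6 * ((a * x) \<bullet> y)\<^sup>2 / nu2"
    unfolding lam_eq using nu2_pos by (simp add: field_simps)
  finally show "curv X Y Y X = (4 - 2 * lam) * gram X Y + 6 * (D X \<bullet> Y)\<^sup>2 / nu2"
    by (simp add: x y rmult_w_hdot gram_def)
  have "((a * x) \<bullet> y)\<^sup>2 / nu2 \<le> ((a \<bullet> a) * gram x y) / nu2"
    using quat_imaginary_cauchy_schwarz[OF qre_a refl, of x y] nu2_pos
    by (intro divide_right_mono) (simp_all add: gram_def)
  then show "(D X \<bullet> Y)\<^sup>2 / nu2 \<le> lam * gram X Y"
    by (simp add: x y rmult_w_hdot gram_def lam_eq)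
qed

text \<open>For \<open>X = w\<close> and \<open>Y = rmult w b\<close> with \<open>b\<close> a unit
  imaginary quaternion, \<open>D X\<close> and \<open>Y\<close> pair to the inner product of
  \<open>a\<close> and \<open>b\<close>; the extremes occur for \<open>b\<close> parallel and
  orthogonal to \<open>a\<close>.\<close>

lemma curv_extremal:
  obtains X Y where "X \<in> horiz" "Y \<in> horiz" "gram X Y = 1" "(D X \<bullet> Y)\<^sup>2 / nu2 = lam"
  and "\<exists>Z \<in> horiz. gram X Z = 1 \<and> D X \<bullet> Z = 0"
proof -
  have apos: "a \<bullet> a > 0" using a_sq pq nu2_pos by simp
  have in_horiz: "rmult w b \<in> horiz" for b
    using w(1) by (simp add: horiz_def hdot_rmult)
  define n where "n = (1 / sqrt (a \<bullet> a)) *\<^sub>R a"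
  have s: "sqrt (a \<bullet> a) * sqrt (a \<bullet> a) = a \<bullet> a" using apos by simp
  have nn: "n \<bullet> n = 1" using apos s by (simp add: n_def divide_simps)
  have an: "a \<bullet> n = sqrt (a \<bullet> a)" using apos s by (simp add: n_def divide_simps)
  have n0: "qre n = 0" using qre_a by (simp add: n_def)
  \<comment> \<open>A quarter turn of the first two imaginary components is orthogonal to
    \<open>n\<close>; if both vanish, \<open>n\<close> is a multiple of the unit k and the unit i
    serves.\<close>
  define o' where "o' = (if qi n = 0 \<and> qj n = 0 then Quat 0 1 0 0
    else (1 / sqrt ((qi n)\<^sup>2 + (qj n)\<^sup>2)) *\<^sub>R Quat 0 (- qj n) (qi n) 0)"
  have o0: "qre o' = 0" by (simp add: o'_def)
  have oo: "o' \<bullet> o' = 1"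
  proof (cases "qi n = 0 \<and> qj n = 0")
    case False
    then have "(qi n)\<^sup>2 + (qj n)\<^sup>2 > 0" using sum_power2_gt_zero_iff by blast
    then have "sqrt ((qi n)\<^sup>2 + (qj n)\<^sup>2) * sqrt ((qi n)\<^sup>2 + (qj n)\<^sup>2) = (qi n)\<^sup>2 + (qj n)\<^sup>2"
      "sqrt ((qi n)\<^sup>2 + (qj n)\<^sup>2) > 0" by simp_all
    then show ?thesis using False by (simp add: o'_def) (simp add: inner_quat_def field_simps power2_eq_square)
  qed (simp add: o'_def inner_quat_def)
  have no: "n \<bullet> o' = 0" using n0 by (auto simp: o'_def inner_quat_def)
  have ao: "a \<bullet> o' = 0" using no apos by (simp add: n_def)
  have g: "gram (rmult w 1) (rmult w b) = 1" if "qre b = 0" "b \<bullet> b = 1" for b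
    using that by (simp add: gram_def rmult_w_hdot one_inner) (simp add: inner_quat_def)
  show ?thesis
  proof (rule that[of "rmult w 1" "rmult w n"])
    show "(D (rmult w 1) \<bullet> rmult w n)\<^sup>2 / nu2 = lam"
      using apos s by (simp add: rmult_w_hdot an lam_eq power2_eq_square)
    show "\<exists>Z \<in> horiz. gram (rmult w 1) Z = 1 \<and> D (rmult w 1) \<bullet> Z = 0"
      by (rule bexI[of _ "rmult w o'"]) (simp_all add: g o0 oo rmult_w_hdot ao in_horiz)
  qed (simp_all add: in_horiz g n0 nn)
qed

end

section \<open>Invariance along circle orbits and bounds for \<open>lam\<close>\<close>

lemma circle_orbit_self: "u \<in> \<Union> (circle_orbit p q (hp_class u))"
proof -
  have e: "expj 0 = 1" by (simp add: expj_def)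
  have "u \<in> hp_class u"
    unfolding hp_class_def by (rule CollectI, rule exI[of _ 1])
      (simp add: rmult_of_real norm_eq_sqrt_inner one_inner)
  moreover have "circle_lift p q 0 v = v" for v by (cases v) (simp add: e)
  then have "circle_action p q 0 X = X" for X by (simp add: circle_action_def)
  ultimately show ?thesis unfolding circle_orbit_def by (metis UnionI rangeI)
qed

lemma norm_expj: "norm (expj t) = 1"
  by (simp add: norm_eq_sqrt_inner inner_quat_def expj_def power2_eq_square[symmetric])

text \<open>Lifts of one orbit differ in the first entry by unit factors on the left and on the
  right. Hence \<open>lam\<close> is a function on the orbifold.\<close>

lemma circle_orbit_fst:
  assumes "v \<in> \<Union> (circle_orbit p q (hp_class u))"
  shows "fst v \<bullet> fst v = fst u \<bullet> fst u"
proof -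
  obtain t h where h: "norm h = 1" and v: "v = circle_lift p q t (rmult u h)"
    using assms by (auto simp: circle_orbit_def circle_action_def hp_class_def)
  have "fst v = expj (real q * t) * (fst u * h)" by (cases u) (simp add: v)
  then have "norm (fst v) = norm (fst u)" by (simp add: norm_quat_mult norm_expj h)
  then show ?thesis by (simp add: dot_square_norm)
qed

context level_point
begin

lemma lam_pos: "lam > 0"
  using pq nu2_pos by (simp add: lam_def)

text \<open>\<open>nu2\<close> lies between \<open>p\<^sup>2\<close> and \<open>p q\<close>, the value at \<open>fst u \<bullet> fst u = p / (p + q)\<close>.\<close>

lemma lam_bounds:
  shows "p \<le> q \<Longrightarrow> real p / real q \<le> lam" "p \<le> q \<Longrightarrow> lam \<le> (real q)\<^sup>2 / (real p)\<^sup>2"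
    and "q \<le> p \<Longrightarrow> (real q)\<^sup>2 / (real p)\<^sup>2 \<le> lam" "q \<le> p \<Longrightarrow> lam \<le> real p / real q"
proof -
  define r where "r = fst u \<bullet> fst u"
  define P where "P = real p"
  define Q where "Q = real q"
  have PQ: "P > 0" "Q > 0" using pq by (simp_all add: P_def Q_def)
  have r: "0 \<le> r" "(P + Q) * r \<le> P" using level_bound by (auto simp: r_def P_def Q_def algebra_simps)
  have nu: "nu2 = P\<^sup>2 + (Q\<^sup>2 - P\<^sup>2) * r" by (simp add: nu2_eq r_def P_def Q_def)
  have nu': "nu2 = P * Q - (Q - P) * (P - (P + Q) * r)"
    unfolding nu by (simp add: algebra_simps power2_eq_square)
  have lam: "lam = P^4 * Q\<^sup>2 / nu2^3" by (simp add: lam_def P_def Q_def)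
  have e1: "P^4 * Q\<^sup>2 / (P\<^sup>2)^3 = Q\<^sup>2 / P\<^sup>2"
    using PQ by (simp add: field_simps flip: power_mult power_add)
  have e2: "P^4 * Q\<^sup>2 / (P * Q)^3 = P / Q"
    using PQ by (simp add: field_simps power4_eq_xxxx power3_eq_cube power2_eq_square)
  have mono: "P^4 * Q\<^sup>2 / y^3 \<le> P^4 * Q\<^sup>2 / x^3" if "0 < x" "x \<le> y" for x y
    using that PQ by (intro divide_left_mono power_mono) auto
  {
    assume "p \<le> q" then have le: "P \<le> Q" by (simp add: P_def Q_def)
    have "P\<^sup>2 \<le> nu2" unfolding nu using r le PQ by (simp add: power_mono)
    from mono[OF _ this] show "lam \<le> (real q)\<^sup>2 / (real p)\<^sup>2"
      using PQ unfolding e1 lam by (simp add: P_def Q_def)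
    have "nu2 \<le> P * Q" unfolding nu' using r le by simp
    from mono[OF nu2_pos this] show "real p / real q \<le> lam"
      unfolding e2 lam by (simp add: P_def Q_def)
  }
  {
    assume "q \<le> p" then have le: "Q \<le> P" by (simp add: P_def Q_def)
    have "(Q\<^sup>2 - P\<^sup>2) * r \<le> 0" using r le PQ by (intro mult_nonpos_nonneg) (simp_all add: power_mono)
    then have "nu2 \<le> P\<^sup>2" unfolding nu by simp
    from mono[OF nu2_pos this] show "(real q)\<^sup>2 / (real p)\<^sup>2 \<le> lam"
      unfolding e1 lam by (simp add: P_def Q_def)
    have "(Q - P) * (P - (P + Q) * r) \<le> 0" using r le by (intro mult_nonpos_nonneg) auto
    then have "P * Q \<le> nu2" unfolding nu' by simp
    from mono[OF _ this] show "lam \<le> real p / real q"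
      using PQ unfolding e2 lam by (simp add: P_def Q_def)
  }
qed

end

section \<open>Moving frames along a map into the zero level\<close>

locale level_map =
  fixes p q :: nat and U :: "(real^4) set" and s :: "real^4 \<Rightarrow> quat3"
  assumes pq: "p > 0" "q > 0" and U: "open U" and smooth_s: "smooth_on U s"
    and s_level: "\<And>x. x \<in> U \<Longrightarrow> s x \<in> level p q"
begin

abbreviation "D \<equiv> circle_velocity p q"

lemma level_point: "x \<in> U \<Longrightarrow> level_point p q (s x)"
  using pq s_level by unfold_locales

definition "nu x = D (s x) \<bullet> D (s x)"
text \<open>\<open>f\<close> and \<open>g\<close> are the connection forms of the Hopf fibration and
  of the circle orbits, pulled back along \<open>s\<close>.\<close>

definition "f i x = hdot (s x) (pd i s x)"
definition "g i x = (D (s x) \<bullet> pd i s x) / nu x"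

text \<open>\<open>cov i\<close> is the directional derivative corrected by the infinitesimal motion of \<open>s\<close> along the
  Hopf fibre and along the circle orbit; thus \<open>e i\<close> is the horizontal lift of the \<open>i\<close>-th coordinate
  field, and the horizontal part of \<open>cov\<close> is the Levi-Civita connection.\<close>

definition "cov i Z x = pd i Z x - rmult (Z x) (f i x) - g i x *\<^sub>R D (Z x)"
definition "e i = cov i s"

lemma nu_eq: "nu x = level_point.nu2 p q (s x)" if "x \<in> U"
  using level_point.nu2_def[OF level_point[OF that]] by (simp add: nu_def)

lemma nu_pos: "x \<in> U \<Longrightarrow> nu x > 0"
  using level_point.nu2_pos[OF level_point] by (simp add: nu_eq)

lemmas smooth_on_D = smooth_on_bounded_linear[OF bounded_linear_circle_velocity U]
lemmas smooth_on_rmult = smooth_on_bilinear[OF bounded_bilinear_rmult U]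
lemmas smooth_on_hdot = smooth_on_bilinear[OF bounded_bilinear_hdot U]

lemmas smooth_level_intros = smooth_intros smooth_on_D smooth_on_rmult smooth_on_hdot U smooth_s

lemma smooth_nu: "smooth_on U nu"
  unfolding nu_def[abs_def] by (intro smooth_level_intros)

lemma smooth_f: "smooth_on U (f i)"
  unfolding f_def[abs_def] by (intro smooth_level_intros)

lemma smooth_g: "smooth_on U (g i)"
  unfolding g_def[abs_def] using nu_pos by (intro smooth_level_intros smooth_nu) (metis less_irrefl)

lemma smooth_cov: "smooth_on U Z \<Longrightarrow> smooth_on U (cov i Z)"
  unfolding cov_def[abs_def] by (intro smooth_level_intros smooth_f smooth_g)

lemma smooth_e: "smooth_on U (e i)"
  unfolding e_def by (intro smooth_cov smooth_s)

lemma cov_cong: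
  assumes "x \<in> U" "smooth_on U A" "\<And>y. y \<in> U \<Longrightarrow> A y = B y"
  shows "cov i A x = cov i B x"
  using pd_cong[OF U assms] assms by (simp add: cov_def)

context
  fixes x assumes x: "x \<in> U"
begin

lemmas pd_rmult = pd_bilinear[OF x bounded_bilinear_rmult]
lemmas pd_hdot = pd_bilinear[OF x bounded_bilinear_hdot]
lemmas pd_inner = pd_bilinear[OF x bounded_bilinear_inner]
lemmas pd_scaleR = pd_bilinear[OF x bounded_bilinear_scaleR]
lemmas pd_D = pd_bounded_linear[OF x bounded_linear_circle_velocity]

lemma s_hdot: "hdot (s x) (s x) = 1" "hdot (s x) (D (s x)) = 0" "hdot (D (s x)) (s x) = 0"
    "hdot (D (s x)) (D (s x)) = of_real (nu x)"
  using level_point.uu[OF level_point[OF x]] level_point.uDu[OF level_point[OF x]]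
    level_point.DuDu[OF level_point[OF x]] by (simp_all add: nu_eq[OF x])

lemma qcnj_f: "qcnj (f i x) = - f i x"
proof -
  have "0 = pd i (\<lambda>y. 1 :: quat) x" by simp
  also have "\<dots> = pd i (\<lambda>y. hdot (s y) (s y)) x"
    by (rule pd_cong[OF U x]) (use level_point.uu(2)[OF level_point] in \<open>auto intro: smooth_intros\<close>)
  also have "\<dots> = f i x + qcnj (f i x)"
    by (simp add: pd_hdot smooth_s f_def hdot_commute[of "pd i s x"])
  finally show ?thesis by (metis add_eq_0_iff)
qed

lemma qre_f: "qre (f i x) = 0"
  using qcnj_f by (simp add: quat_imaginary_iff)

text \<open>Differentiating the moment equation and using that \<open>D\<close> is skew shows this
  component to be self-conjugate, hence real.\<close>

lemma hdot_Ds_pd: "hdot (D (s x)) (pd i s x) = of_real (D (s x) \<bullet> pd i s x)"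
proof -
  have "0 = pd i (\<lambda>y. 0 :: quat) x" by simp
  also have "\<dots> = pd i (\<lambda>y. hdot (s y) (D (s y))) x"
    by (rule pd_cong[OF U x]) (use level_point.uDu(1)[OF level_point] in \<open>auto intro: smooth_intros\<close>)
  also have "\<dots> = hdot (s x) (D (pd i s x)) + hdot (pd i s x) (D (s x))"
    by (simp add: pd_hdot pd_D smooth_s smooth_on_D)
  also have "\<dots> = qcnj (hdot (D (s x)) (pd i s x)) - hdot (D (s x)) (pd i s x)"
    by (simp add: hdot_circle_velocity[of p q "s x"] hdot_commute[of "pd i s x" "D (s x)"])
  finally have "qcnj (hdot (D (s x)) (pd i s x)) = hdot (D (s x)) (pd i s x)" by simp
  then show ?thesis by (metis quat_real_iff inner_eq_qre_hdot)
qed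

lemma s_inner_pd: "s x \<bullet> pd i s x = 0"
  using qre_f by (simp add: inner_eq_qre_hdot f_def)

lemma orbifold_horizontal_pd: "orbifold_horizontal p q (s x) (pd i s x) = e i x"
  by (simp add: level_point.orbifold_horizontal_eq[OF level_point[OF x]] s_inner_pd e_def cov_def f_def g_def nu_eq[OF x])

lemma e_horiz: "e i x \<in> level_point.horiz p q (s x)"
  using level_point.orbifold_horizontal_in_horiz[OF level_point[OF x] s_inner_pd hdot_Ds_pd]
  by (simp add: orbifold_horizontal_pd)

lemma e_hdot: "hdot (s x) (e i x) = 0" "hdot (D (s x)) (e i x) = 0"
    "hdot (s x) (D (e i x)) = 0"
  using level_point.horizD[OF level_point[OF x] e_horiz] by auto

lemma orbifold_horizontal_derivative:
  "orbifold_horizontal p q (s x) (frechet_derivative s (at x) v) = (\<Sum>i\<in>UNIV. v $ i *\<^sub>R e i x)"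
proof -
  have lin: "linear (orbifold_horizontal p q (s x))"
    by (rule linearI)
      (simp_all add: level_point.orbifold_horizontal_eq[OF level_point[OF x]] hdot_simps rmult_simps
        inner_add_right add_divide_distrib algebra_simps del: of_real_mult)
  have lin2: "linear (frechet_derivative s (at x))"
    using smooth_on_has_derivative[OF smooth_s x] by (simp add: has_derivative_linear)
  have "v = (\<Sum>i\<in>UNIV. v $ i *\<^sub>R axis i 1)"
    using basis_expansion[of v] by (simp add: scalar_mult_eq_scaleR)
  then have "orbifold_horizontal p q (s x) (frechet_derivative s (at x) v) =
     orbifold_horizontal p q (s x) (frechet_derivative s (at x) (\<Sum>i\<in>UNIV. v $ i *\<^sub>R axis i 1))"
    by simp
  also have "\<dots> = (\<Sum>i\<in>UNIV. v $ i *\<^sub>R orbifold_horizontal p q (s x) (pd i s x))"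
    by (simp add: linear_sum[OF lin] linear_sum[OF lin2] linear_cmul[OF lin] linear_cmul[OF lin2] pd_def)
  finally show ?thesis by (simp add: orbifold_horizontal_pd)
qed

lemma orbifold_metric_eq: "orbifold_metric p q s x $ i $ j = e i x \<bullet> e j x"
  by (simp add: orbifold_metric_def pd_def[symmetric] orbifold_horizontal_pd)

text \<open>The \<open>g\<close> terms cancel because \<open>D\<close> is skew; the \<open>f\<close>
  terms leave a commutator, since the values of \<open>hdot\<close> are conjugated under motion
  along the Hopf fibre.\<close>

lemma pd_hdot_cov:
  assumes "smooth_on U A" "smooth_on U B"
  shows "pd i (\<lambda>y. hdot (A y) (B y)) x =
    hdot (cov i A x) (B x) + hdot (A x) (cov i B x) - f i x * hdot (A x) (B x) + hdot (A x) (B x) * f i x"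
  by (simp add: pd_hdot assms cov_def hdot_simps qcnj_f hdot_circle_velocity[of p q "A x"])

text \<open>Metric compatibility: right multiplication by the imaginary \<open>f i x\<close> and the
  operator \<open>D\<close> are both skew for the inner product.\<close>

lemma pd_inner_cov:
  assumes "smooth_on U A" "smooth_on U B"
  shows "pd i (\<lambda>y. A y \<bullet> B y) x = cov i A x \<bullet> B x + A x \<bullet> cov i B x"
proof -
  have "rmult (A x) (f i x) \<bullet> B x = - (A x \<bullet> rmult (B x) (f i x))"
    using qre_f unfolding inner_rmult_left inner_rmult_right hdot_commute[of "B x" "A x"]
    by (simp add: inner_quat_def)
  then show ?thesis
    by (simp add: pd_inner assms cov_def inner_diff_left inner_diff_right inner_circle_velocity[of p q "A x"])
qed

lemma cov_D: "smooth_on U A \<Longrightarrow> cov i (\<lambda>y. D (A y)) x = D (cov i A x)"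
  by (simp add: cov_def pd_D circle_velocity_linear circle_velocity_rmult)

lemma cov_rmult:
  assumes "smooth_on U A" "smooth_on U h"
  shows "cov i (\<lambda>y. rmult (A y) (h y)) x =
    rmult (cov i A x) (h x) + rmult (A x) (pd i h x + f i x * h x - h x * f i x)"
  by (simp add: cov_def pd_rmult assms rmult_simps circle_velocity_rmult algebra_simps)

lemma cov_scaleR:
  assumes "smooth_on U A" "smooth_on U c"
  shows "cov i (\<lambda>y. c y *\<^sub>R A y) x = pd i c x *\<^sub>R A x + c x *\<^sub>R cov i A x"
  by (simp add: cov_def pd_scaleR assms rmult_simps circle_velocity_linear algebra_simps)

lemma cov_diff:
  assumes "smooth_on U A" "smooth_on U B"
  shows "cov i (\<lambda>y. A y - B y) x = cov i A x - cov i B x"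
  by (simp add: cov_def pd_diff[OF x] assms rmult_simps circle_velocity_linear algebra_simps)

lemma cov_sum:
  assumes "\<And>k. smooth_on U (A k)"
  shows "cov i (\<lambda>y. \<Sum>k\<in>(UNIV :: 4 set). A k y) x = (\<Sum>k\<in>UNIV. cov i (A k) x)"
proof -
  have "bounded_linear (\<lambda>v. rmult v (f i x))"
    by (rule bounded_bilinear.bounded_linear_left[OF bounded_bilinear_rmult])
  then have "rmult (\<Sum>k\<in>UNIV. A k x) (f i x) = (\<Sum>k\<in>UNIV. rmult (A k x) (f i x))"
    using linear_sum[OF bounded_linear.linear] by blast
  then show ?thesis
    by (simp add: cov_def pd_sum[OF x] assms sum_subtractf scaleR_sum_right
        linear_sum[OF bounded_linear.linear[OF bounded_linear_circle_velocity]])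
qed

text \<open>The curvature forms of the two connections; the commutator in \<open>F\<close> is due to
  the nonabelian group of unit quaternions.\<close>

definition "F i j = pd i (f j) x - pd j (f i) x + f i x * f j x - f j x * f i x"
definition "G i j = pd i (g j) x - pd j (g i) x"

text \<open>Second partial derivatives commute, and \<open>D\<close> commutes with right
  multiplication, so only the curvature forms remain.\<close>

lemma cov_commutator:
  assumes Z: "smooth_on U Z"
  shows "cov i (cov j Z) x - cov j (cov i Z) x = - rmult (Z x) (F i j) - G i j *\<^sub>R D (Z x)"
proof -
  have pdcov: "pd i (cov j Z) x = pd i (pd j Z) x - (rmult (Z x) (pd i (f j) x) + rmult (pd i Z x) (f j x))
    - (g j x *\<^sub>R D (pd i Z x) + pd i (g j) x *\<^sub>R D (Z x))" for i j
    unfolding cov_def[abs_def]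
    by (simp add: pd_diff[OF x] pd_rmult pd_scaleR pd_D smooth_level_intros smooth_f smooth_g Z)
  show ?thesis
    unfolding cov_def[of i "cov j Z"] cov_def[of j "cov i Z"] pdcov pd_commute[OF U x Z, of j i]
    by (simp add: cov_def F_def G_def rmult_simps circle_velocity_linear circle_velocity_rmult algebra_simps)
qed

text \<open>Differentiating the horizontality of \<open>e j\<close> yields the normal components of
  its corrected derivative.\<close>

lemma hdot_cov_e: "hdot (s x) (cov i (e j) x) = - hdot (e i x) (e j x)"
    "hdot (D (s x)) (cov i (e j) x) = - hdot (D (e i x)) (e j x)"
proof -
  have "0 = pd i (\<lambda>y. 0 :: quat) x" by simp
  also have "\<dots> = pd i (\<lambda>y. hdot (s y) (e j y)) x"
    by (rule pd_cong[OF U x]) (use level_point.horizD(1)[OF level_point level_map.e_horiz[OF level_map_axioms]] in \<open>auto intro: smooth_intros\<close>)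
  also have "\<dots> = hdot (e i x) (e j x) + hdot (s x) (cov i (e j) x)"
    by (simp add: pd_hdot_cov smooth_s smooth_e e_hdot) (simp add: e_def)
  finally show "hdot (s x) (cov i (e j) x) = - hdot (e i x) (e j x)" by (metis add_eq_0_iff)
  have "0 = pd i (\<lambda>y. 0 :: quat) x" by simp
  also have "\<dots> = pd i (\<lambda>y. hdot (D (s y)) (e j y)) x"
    by (rule pd_cong[OF U x]) (use level_point.horizD(2)[OF level_point level_map.e_horiz[OF level_map_axioms]] in \<open>auto intro: smooth_intros\<close>)
  also have "\<dots> = hdot (D (e i x)) (e j x) + hdot (D (s x)) (cov i (e j) x)"
    by (simp add: pd_hdot_cov smooth_s smooth_e e_hdot smooth_on_D cov_D) (simp add: e_def)
  finally show "hdot (D (s x)) (cov i (e j) x) = - hdot (D (e i x)) (e j x)" by (metis add_eq_0_iff)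
qed

text \<open>The commutator is applied to \<open>s\<close> itself, where \<open>cov j s\<close> is
  \<open>e j\<close>; its components along \<open>s\<close> and \<open>D s\<close> give both forms
  without differentiating \<open>f\<close> or \<open>g\<close>.\<close>

lemma F_eq: "F i j = hdot (e i x) (e j x) - hdot (e j x) (e i x)"
  and G_eq: "G i j = 2 * (D (e i x) \<bullet> e j x) / nu x"
proof -
  have c: "cov i (e j) x - cov j (e i) x = - rmult (s x) (F i j) - G i j *\<^sub>R D (s x)"
    using cov_commutator[OF smooth_s] by (simp add: e_def)
  have "hdot (s x) (cov i (e j) x - cov j (e i) x) = - F i j"
    unfolding c by (simp add: hdot_simps s_hdot)
  then have "- F i j = - hdot (e i x) (e j x) + hdot (e j x) (e i x)"
    by (simp add: hdot_simps hdot_cov_e)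
  then show "F i j = hdot (e i x) (e j x) - hdot (e j x) (e i x)"
    by (metis minus_diff_eq minus_minus uminus_add_conv_diff)
  have "D (s x) \<bullet> (cov i (e j) x - cov j (e i) x) = - G i j * nu x"
    unfolding c by (simp add: inner_diff_right inner_rmult_right s_hdot nu_def)
  then have "- G i j * nu x = - (D (e i x) \<bullet> e j x) + D (e j x) \<bullet> e i x"
    by (simp add: inner_eq_qre_hdot hdot_simps hdot_cov_e)
  also have "D (e j x) \<bullet> e i x = - (D (e i x) \<bullet> e j x)"
    by (metis inner_circle_velocity inner_commute)
  finally show "G i j = 2 * (D (e i x) \<bullet> e j x) / nu x"
    using nu_pos[OF x] by (simp add: field_simps)
qed

text \<open>Vanishing torsion of the horizontal part: the commutator on \<open>s\<close> lies along
  \<open>s\<close> and \<open>D s\<close>, both orthogonal to \<open>e k x\<close>.\<close>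

lemma cov_e_symmetric: "cov i (e j) x \<bullet> e k x = cov j (e i) x \<bullet> e k x"
proof -
  have "cov i (e j) x - cov j (e i) x = - rmult (s x) (F i j) - G i j *\<^sub>R D (s x)"
    using cov_commutator[OF smooth_s] by (simp add: e_def)
  then have "(cov i (e j) x - cov j (e i) x) \<bullet> e k x = - (rmult (s x) (F i j) \<bullet> e k x) - G i j * (D (s x) \<bullet> e k x)"
    by (simp add: inner_diff_left)
  also have "\<dots> = 0"
    by (simp add: inner_rmult_left e_hdot) (simp add: inner_eq_qre_hdot e_hdot)
  finally show ?thesis by (simp add: inner_diff_left)
qed

lemma koszul:
  "pd i (\<lambda>y. e j y \<bullet> e l y) x + pd j (\<lambda>y. e i y \<bullet> e l y) x - pd l (\<lambda>y. e i y \<bullet> e j y) x =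
    2 * (cov i (e j) x \<bullet> e l x)"
  using cov_e_symmetric[of i l j] cov_e_symmetric[of j l i] cov_e_symmetric[of i j l]
  by (simp add: pd_inner_cov smooth_e inner_commute)

end

end

section \<open>Sectional curvature in an orbifold chart\<close>

context level_point
begin

lemma linear_curv:
  "linear (\<lambda>X. curv X Y Z V)" "linear (\<lambda>Y. curv X Y Z V)" "linear (\<lambda>Z. curv X Y Z V)" "linear (\<lambda>V. curv X Y Z V)"
  by (rule linearI; simp add: curv_def hdot_simps rmult_simps circle_velocity_linear circle_velocity_rmult
      inner_add_left inner_add_right inner_diff_left inner_diff_right add_divide_distrib diff_divide_distrib algebra_simps)+

end

context level_map
begin

abbreviation "met \<equiv> orbifold_metric p q s"
abbreviation "lift x v \<equiv> (\<Sum>i\<in>UNIV. v $ i *\<^sub>R e i x)"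

lemma smooth_met: "smooth_on U (\<lambda>x. met x $ i $ j)"
  by (subst smooth_on_cong[OF U orbifold_metric_eq]) (auto intro: smooth_intros U smooth_e)

lemma met_mult: "x \<in> U \<Longrightarrow> (met x *v v) $ i = e i x \<bullet> lift x v"
  by (simp add: matrix_vector_mult_def orbifold_metric_eq inner_sum_right mult.commute)

lemma metric_inner_eq: "x \<in> U \<Longrightarrow> metric_inner met x v w = lift x v \<bullet> lift x w"
  by (simp add: metric_inner_def inner_vec_def met_mult inner_sum_left)

lemma det_met_iff:
  assumes x: "x \<in> U"
  shows "det (met x) \<noteq> 0 \<longleftrightarrow> (\<forall>v. lift x v = 0 \<longrightarrow> v = 0)"
proof -
  have "met x *v v = 0 \<longleftrightarrow> lift x v = 0" for v
  proof
    assume "met x *v v = 0"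
    then have "lift x v \<bullet> lift x v = 0"
      using metric_inner_eq[OF x, of v v] by (simp add: metric_inner_def)
    then show "lift x v = 0" by simp
  next
    assume "lift x v = 0"
    then show "met x *v v = 0" by (simp add: vec_eq_iff met_mult[OF x])
  qed
  then show ?thesis
    using matrix_left_invertible_ker[of "met x"] invertible_left_inverse[of "met x"] invertible_det_nz[of "met x"] by simp
qed

end

locale level_chart = level_map +
  assumes independent: "\<And>x v. x \<in> U \<Longrightarrow> (\<Sum>i\<in>UNIV. v $ i *\<^sub>R e i x) = 0 \<Longrightarrow> v = 0"
begin

lemma det_met: "x \<in> U \<Longrightarrow> det (met x) \<noteq> 0"
  using det_met_iff independent by blast

lemma smooth_christoffel: "smooth_on U (christoffel met k i j)"
proof -
  have d: "smooth_on U (\<lambda>x. pd i (\<lambda>y. met y $ j $ l) x)" for i j l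
    by (rule smooth_on_pd[OF smooth_met])
  have "smooth_on U (\<lambda>x. matrix_inv (met x) $ k $ l * (pd i (\<lambda>y. met y $ j $ l) x
      + pd j (\<lambda>y. met y $ i $ l) x - pd l (\<lambda>y. met y $ i $ j) x))" for l
    by (intro smooth_on_mult smooth_on_diff smooth_on_add smooth_on_matrix_inv smooth_met det_met d U)
  then show ?thesis
    unfolding christoffel_def[abs_def] pderiv_at_eq_pd
    by (intro smooth_on_divide smooth_on_sum smooth_on_const U) auto
qed

context
  fixes x assumes x: "x \<in> U"
begin

interpretation lp: level_point p q "s x" by (rule level_point[OF x])

lemma lift_horiz: "lift x v \<in> lp.horiz"
  using e_horiz[OF x] by (simp add: lp.horiz_def hdot_simps linear_sum[OF bounded_linear.linear[OF bounded_bilinear.bounded_linear_right[OF bounded_bilinear_hdot]]])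

text \<open>The normalized first frame vector spans the horizontal line over H, so taking its
  coordinate is an injection between spaces of real dimension four.\<close>

lemma lift_surj:
  assumes "Z \<in> lp.horiz"
  obtains v where "Z = lift x v"
proof -
  have linl: "linear (lift x)"
    by (rule linearI) (simp_all add: scaleR_add_left sum.distrib scaleR_sum_right)
  define e1 where "e1 = lift x (axis 1 1)"
  have "axis 1 1 \<noteq> (0 :: real^4)" by (simp add: axis_eq_0_iff)
  then have e1: "e1 \<noteq> 0" using independent[OF x, of "axis 1 1"] e1_def by auto
  define w where "w = (1 / norm e1) *\<^sub>R e1"
  have w: "w \<in> lp.horiz" "w \<bullet> w = 1"
    using lift_horiz[of "axis 1 1"] e1
    by (simp_all add: w_def e1_def[symmetric] lp.horiz_def hdot_simps dot_square_norm power2_eq_square)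
  interpret lf: level_frame p q "s x" w by unfold_locales (use w in auto)
  have lin: "linear (\<lambda>v. hdot w (lift x v))"
    by (rule linear_compose[OF linl bounded_linear.linear[OF bounded_bilinear.bounded_linear_right[OF bounded_bilinear_hdot]], unfolded o_def])
  have "v = 0" if "hdot w (lift x v) = 0" for v
    using lf.horiz_decomposition[OF lift_horiz[of v]] that independent[OF x, of v] by (simp add: rmult_0)
  then have "inj (\<lambda>v. hdot w (lift x v))"
    unfolding linear_injective_0[OF lin] by blast
  then have "surj (\<lambda>v. hdot w (lift x v))"
    using linear_injective_imp_surjective[OF lin] by (simp add: DIM_quat)
  from surjD[OF this, of "hdot w Z"] obtain v where "hdot w (lift x v) = hdot w Z" by auto
  then have "Z = lift x v"
    using lf.horiz_decomposition[OF assms] lf.horiz_decomposition[OF lift_horiz[of v]] by simp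
  then show ?thesis by (rule that)
qed

lemma horiz_eq_0:
  assumes "Z \<in> lp.horiz" "\<And>k. Z \<bullet> e k x = 0"
  shows "Z = 0"
proof -
  obtain v where v: "Z = lift x v" using lift_surj[OF assms(1)] .
  have "Z \<bullet> Z = Z \<bullet> lift x v" by (simp add: v)
  also have "\<dots> = 0" by (simp add: inner_sum_right assms(2))
  finally show ?thesis by simp
qed

text \<open>By \<open>koszul\<close> the Christoffel symbols are the inverse metric applied to the
  products on the right; multiplication by the metric undoes this.\<close>

lemma christoffel_sum: "(\<Sum>l\<in>UNIV. (e k x \<bullet> e l x) * christoffel met l i j x) = cov i (e j) x \<bullet> e k x"
proof -
  have pd: "pderiv_at (\<lambda>y. met y $ j $ l) i x = pd i (\<lambda>y. e j y \<bullet> e l y) x" for i j l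
    unfolding pderiv_at_eq_pd
    by (rule pd_cong[OF U x smooth_met orbifold_metric_eq])
  define c where "c = (\<chi> l. cov i (e j) x \<bullet> e l x)"
  have "christoffel met l i j x = (matrix_inv (met x) *v c) $ l" for l
    unfolding christoffel_def pd koszul[OF x]
    by (simp add: matrix_vector_mult_def c_def sum_divide_distrib)
  then have "(\<Sum>l\<in>UNIV. (e k x \<bullet> e l x) * christoffel met l i j x) = (met x *v (matrix_inv (met x) *v c)) $ k"
    by (simp add: matrix_vector_mult_def[of "met x"] orbifold_metric_eq[OF x])
  also have "\<dots> = cov i (e j) x \<bullet> e k x"
    by (simp add: matrix_vector_mul_assoc matrix_inv_inverse[OF det_met[OF x]] c_def)
  finally show ?thesis .
qed

lemma hdot_sum: "hdot u (\<Sum>k\<in>(UNIV :: 4 set). A k) = (\<Sum>k\<in>UNIV. hdot u (A k))"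
  by (rule linear_sum[OF bounded_linear.linear[OF bounded_bilinear.bounded_linear_right[OF bounded_bilinear_hdot]]])

text \<open>The difference of the two sides is horizontal by \<open>hdot_cov_e\<close> and
  orthogonal to every \<open>e k x\<close> by \<open>christoffel_sum\<close>, hence zero.\<close>

lemma cov_e_decomposition:
  "cov i (e j) x = (\<Sum>k\<in>UNIV. christoffel met k i j x *\<^sub>R e k x) - rmult (s x) (hdot (e i x) (e j x))
    - rmult (D (s x)) ((1 / nu x) *\<^sub>R hdot (D (e i x)) (e j x))"
proof -
  define Z where "Z = cov i (e j) x - (\<Sum>k\<in>UNIV. christoffel met k i j x *\<^sub>R e k x) + rmult (s x) (hdot (e i x) (e j x))
    + rmult (D (s x)) ((1 / nu x) *\<^sub>R hdot (D (e i x)) (e j x))"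
  have "Z \<in> lp.horiz"
    using nu_pos[OF x]
    by (simp add: Z_def lp.horiz_def hdot_simps hdot_sum e_hdot[OF x] hdot_cov_e[OF x] s_hdot[OF x])
      (simp add: of_real_def)
  moreover have "Z \<bullet> e k x = 0" for k
  proof -
    have "Z \<bullet> e k x = cov i (e j) x \<bullet> e k x - (\<Sum>l\<in>UNIV. (e k x \<bullet> e l x) * christoffel met l i j x)"
      by (simp add: Z_def inner_add_left inner_diff_left inner_rmult_left e_hdot[OF x] inner_sum_left mult.commute
          inner_commute[of "e k x"])
    then show ?thesis by (simp add: christoffel_sum)
  qed
  ultimately have "Z = 0" by (rule horiz_eq_0)
  then show ?thesis by (simp add: Z_def algebra_simps)
qed

end

section \<open>Comparison of the coordinate Riemann tensor with \<open>curv\<close>\<close>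

context
  fixes x assumes x: "x \<in> U"
begin

interpretation lp: level_point p q "s x" by (rule level_point[OF x])

text \<open>The decomposition of \<open>cov j (e k)\<close> is differentiated again. Paired with a
  horizontal vector, its normal terms count only where the derivative falls on \<open>s\<close> or
  \<open>D s\<close>, which become \<open>e i\<close> and \<open>D (e i)\<close>.\<close>

lemma cov_cov_e:
  "cov i (cov j (e k)) x \<bullet> e m x =
     (\<Sum>l\<in>UNIV. pd i (christoffel met l j k) x * (e l x \<bullet> e m x))
     + (\<Sum>l\<in>UNIV. \<Sum>n\<in>UNIV. christoffel met l j k x * christoffel met n i l x * (e n x \<bullet> e m x))
     - rmult (e i x) (hdot (e j x) (e k x)) \<bullet> e m x
     - rmult (D (e i x)) (hdot (D (e j x)) (e k x)) \<bullet> e m x / nu x"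
proof -
  define A where "A y = (\<Sum>l\<in>UNIV. christoffel met l j k y *\<^sub>R e l y)" for y
  define B where "B y = rmult (s y) (hdot (e j y) (e k y))" for y
  define C where "C y = rmult (D (s y)) ((1 / nu y) *\<^sub>R hdot (D (e j y)) (e k y))" for y
  have sl: "smooth_on U (\<lambda>y. christoffel met l j k y *\<^sub>R e l y)" for l
    by (intro smooth_intros U smooth_christoffel smooth_e)
  have sA: "smooth_on U A" unfolding A_def[abs_def] by (intro smooth_on_sum U sl)
  have sh: "smooth_on U (\<lambda>y. hdot (e j y) (e k y))" by (intro smooth_on_hdot smooth_e)
  have sh2: "smooth_on U (\<lambda>y. (1 / nu y) *\<^sub>R hdot (D (e j y)) (e k y))"
    by (intro smooth_on_scaleR smooth_on_divide smooth_on_const smooth_on_hdot smooth_on_D smooth_e smooth_nu U)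
      (use nu_pos in force)
  have sB: "smooth_on U B" unfolding B_def[abs_def] by (intro smooth_on_rmult smooth_s sh)
  have sC: "smooth_on U C" unfolding C_def[abs_def] by (intro smooth_on_rmult smooth_on_D smooth_s sh2)
  have cs: "cov i s x = e i x" by (simp add: e_def)
  have "cov i (cov j (e k)) x = cov i (\<lambda>y. A y - B y - C y) x"
    by (rule cov_cong[OF x smooth_cov[OF smooth_e]]) (simp add: cov_e_decomposition A_def B_def C_def)
  also have "\<dots> = cov i A x - cov i B x - cov i C x"
    by (simp add: cov_diff[OF x] sA sB sC smooth_on_diff U)
  finally have "cov i (cov j (e k)) x \<bullet> e m x = cov i A x \<bullet> e m x - cov i B x \<bullet> e m x - cov i C x \<bullet> e m x"
    by (simp add: inner_diff_left)
  moreover have "cov i B x \<bullet> e m x = rmult (e i x) (hdot (e j x) (e k x)) \<bullet> e m x"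
    unfolding B_def[abs_def] cov_rmult[OF x smooth_s sh] cs
    by (simp add: inner_add_left inner_rmult_left[of "s x"] e_hdot[OF x])
  moreover have "cov i C x \<bullet> e m x = rmult (D (e i x)) (hdot (D (e j x)) (e k x)) \<bullet> e m x / nu x"
    unfolding C_def[abs_def] cov_rmult[OF x smooth_on_D[OF smooth_s] sh2] cov_D[OF x smooth_s] cs
    by (simp add: inner_add_left inner_diff_left inner_rmult_left[of "D (s x)"] e_hdot[OF x] rmult_simps)
  moreover have "cov i A x \<bullet> e m x = (\<Sum>l\<in>UNIV. pd i (christoffel met l j k) x * (e l x \<bullet> e m x))
     + (\<Sum>l\<in>UNIV. christoffel met l j k x * (cov i (e l) x \<bullet> e m x))"
    unfolding A_def[abs_def] cov_sum[OF x sl] cov_scaleR[OF x smooth_e smooth_christoffel]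
    by (simp add: inner_sum_left inner_add_left sum.distrib)
  moreover have "christoffel met l j k x * (cov i (e l) x \<bullet> e m x) =
     (\<Sum>n\<in>UNIV. christoffel met l j k x * christoffel met n i l x * (e n x \<bullet> e m x))" for l
    unfolding christoffel_sum[OF x, symmetric] sum_distrib_left
    by (simp add: mult_ac inner_commute)
  ultimately show ?thesis by simp
qed

text \<open>Antisymmetrize \<open>cov_cov_e\<close> in \<open>i\<close> and \<open>j\<close>, and
  evaluate the commutator by \<open>F_eq\<close> and \<open>G_eq\<close>.\<close>

lemma riemann_eq_curv:
  "(\<Sum>l\<in>UNIV. riemann met l i j k x * (e l x \<bullet> e m x)) = lp.curv (e i x) (e j x) (e k x) (e m x)"
proof -
  have swap: "(\<Sum>l\<in>UNIV. \<Sum>n\<in>UNIV. christoffel met l j k x * christoffel met n i l x * (e n x \<bullet> e m x)) =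
    (\<Sum>l\<in>UNIV. (\<Sum>n\<in>UNIV. christoffel met l i n x * christoffel met n j k x) * (e l x \<bullet> e m x))" for i j
    by (subst sum.swap) (simp add: sum_distrib_left sum_distrib_right mult_ac)
  have "(\<Sum>l\<in>UNIV. riemann met l i j k x * (e l x \<bullet> e m x)) =
    ((\<Sum>l\<in>UNIV. pd i (christoffel met l j k) x * (e l x \<bullet> e m x))
     + (\<Sum>l\<in>UNIV. \<Sum>n\<in>UNIV. christoffel met l j k x * christoffel met n i l x * (e n x \<bullet> e m x)))
   - ((\<Sum>l\<in>UNIV. pd j (christoffel met l i k) x * (e l x \<bullet> e m x))
     + (\<Sum>l\<in>UNIV. \<Sum>n\<in>UNIV. christoffel met l i k x * christoffel met n j l x * (e n x \<bullet> e m x)))"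
    unfolding swap riemann_def pderiv_at_eq_pd
    by (simp add: sum_subtractf sum.distrib algebra_simps)
  also have "\<dots> = (cov i (cov j (e k)) x - cov j (cov i (e k)) x) \<bullet> e m x
     + rmult (e i x) (hdot (e j x) (e k x)) \<bullet> e m x - rmult (e j x) (hdot (e i x) (e k x)) \<bullet> e m x
     + (rmult (D (e i x)) (hdot (D (e j x)) (e k x)) \<bullet> e m x
       - rmult (D (e j x)) (hdot (D (e i x)) (e k x)) \<bullet> e m x) / nu x"
    unfolding inner_diff_left cov_cov_e by (simp add: diff_divide_distrib)
  also have "\<dots> = lp.curv (e i x) (e j x) (e k x) (e m x)"
    unfolding cov_commutator[OF x smooth_e] F_eq[OF x] G_eq[OF x] lp.curv_def nu_eq[OF x]
    by (simp add: inner_diff_left)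
  finally show ?thesis .
qed

lemma curv_lift:
  "lp.curv (lift x v) (lift x w) (lift x z) (lift x t) =
    (\<Sum>i\<in>UNIV. \<Sum>j\<in>UNIV. \<Sum>k\<in>UNIV. \<Sum>m\<in>UNIV.
      v $ i * (w $ j * (z $ k * (t $ m * lp.curv (e i x) (e j x) (e k x) (e m x)))))"
proof -
  have c: "lp.curv (lift x v) Y Z T = (\<Sum>i\<in>UNIV. v $ i * lp.curv (e i x) Y Z T)"
    "lp.curv X (lift x v) Z T = (\<Sum>i\<in>UNIV. v $ i * lp.curv X (e i x) Z T)"
    "lp.curv X Y (lift x v) T = (\<Sum>i\<in>UNIV. v $ i * lp.curv X Y (e i x) T)"
    "lp.curv X Y Z (lift x v) = (\<Sum>i\<in>UNIV. v $ i * lp.curv X Y Z (e i x))" for v X Y Z T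
    by (simp_all add: lp.linear_curv[THEN linear_sum] lp.linear_curv[THEN linear_cmul])
  show ?thesis unfolding c(1) unfolding c(2) unfolding c(3) unfolding c(4) sum_distrib_left ..
qed

lemma curvature_op_inner:
  "metric_inner met x (curvature_op met x v w z) t = lp.curv (lift x v) (lift x w) (lift x z) (lift x t)"
proof -
  have "metric_inner met x (curvature_op met x v w z) t =
    (\<Sum>m\<in>UNIV. \<Sum>l\<in>UNIV. curvature_op met x v w z $ l * (t $ m * (e l x \<bullet> e m x)))"
    by (simp add: metric_inner_eq[OF x] inner_sum_left inner_sum_right sum_distrib_left mult_ac)
  also have "\<dots> = (\<Sum>m\<in>UNIV. \<Sum>l\<in>UNIV. \<Sum>i\<in>UNIV. \<Sum>j\<in>UNIV. \<Sum>k\<in>UNIV.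
      v $ i * (w $ j * (z $ k * (t $ m * (riemann met l i j k x * (e l x \<bullet> e m x))))))"
    by (simp add: curvature_op_def sum_distrib_left sum_distrib_right mult_ac)
  also have "\<dots> = (\<Sum>m\<in>UNIV. \<Sum>i\<in>UNIV. \<Sum>j\<in>UNIV. \<Sum>k\<in>UNIV. \<Sum>l\<in>UNIV.
      v $ i * (w $ j * (z $ k * (t $ m * (riemann met l i j k x * (e l x \<bullet> e m x))))))"
    by (rule sum.cong[OF refl], subst sum.swap, rule sum.cong[OF refl],
        subst sum.swap, rule sum.cong[OF refl], rule sum.swap)
  also have "\<dots> = (\<Sum>m\<in>UNIV. \<Sum>i\<in>UNIV. \<Sum>j\<in>UNIV. \<Sum>k\<in>UNIV.
      v $ i * (w $ j * (z $ k * (t $ m * lp.curv (e i x) (e j x) (e k x) (e m x)))))"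
    by (simp add: sum_distrib_left[symmetric] riemann_eq_curv)
  also have "\<dots> = (\<Sum>i\<in>UNIV. \<Sum>j\<in>UNIV. \<Sum>k\<in>UNIV. \<Sum>m\<in>UNIV.
      v $ i * (w $ j * (z $ k * (t $ m * lp.curv (e i x) (e j x) (e k x) (e m x)))))"
    by (subst sum.swap, rule sum.cong[OF refl], subst sum.swap, rule sum.cong[OF refl], rule sum.swap)
  finally show ?thesis by (simp only: curv_lift)
qed

lemma sectional_curvature_eq:
  "sectional_curvature met x v w =
    lp.curv (lift x v) (lift x w) (lift x w) (lift x v) / gram (lift x v) (lift x w)"
  unfolding sectional_curvature_def curvature_op_inner by (simp add: metric_inner_eq[OF x] gram_def)

end

end

section \<open>Existence of orbifold charts\<close>

text \<open>Two quaternionic equations in three unknowns: \<phi> has zero third entry, so it is not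
  onto and therefore has a kernel.\<close>

lemma (in level_point) exists_unit_horiz:
  obtains w where "w \<in> horiz" "w \<bullet> w = 1"
proof -
  define \<phi> where "\<phi> Z = (hdot u Z, hdot (D u) Z, 0 :: quat)" for Z
  have lin: "linear \<phi>" by (rule linearI) (simp_all add: \<phi>_def hdot_simps)
  have "(0, 0, 1) \<notin> range \<phi>" by (auto simp: \<phi>_def)
  then have "\<not> surj \<phi>" by blast
  then have "\<not> inj \<phi>" using linear_injective_imp_surjective[OF lin] by auto
  then obtain Z where Z: "\<phi> Z = 0" "Z \<noteq> 0" unfolding linear_injective_0[OF lin] by blast
  then have "Z \<in> horiz" by (simp add: \<phi>_def horiz_def zero_prod_def)
  then show ?thesis
    using Z(2) by (intro that[of "(1 / norm Z) *\<^sub>R Z"]) (simp_all add: horiz_def hdot_simps dot_square_norm power2_eq_square)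
qed

text \<open>Conjugation by \<open>N M - c b\<close> turns the direction of the imaginary quaternion \<open>c\<close> into that of \<open>b\<close>.\<close>

lemma quat_rotation:
  assumes b: "qre b = 0" and c: "qre c = 0" and N: "N * N = b \<bullet> b" and M: "M * M = c \<bullet> c"
  defines "h \<equiv> of_real (N * M) - c * b"
  shows "qcnj h * c * h = (2 * (M * M) * (N * M + b \<bullet> c)) *\<^sub>R b"
    and "h \<bullet> c = 0"
proof -
  define r where "r = N * M"
  have bb: "b * b = - of_real (N * N)" and cc: "c * c = - of_real (M * M)"
    unfolding N M using b c by (simp_all add: quat_eq_iff inner_quat_def)
  have bc: "b * c = - ((2 * (b \<bullet> c)) *\<^sub>R 1) - c * b"
    using b c by (simp add: quat_eq_iff inner_quat_def algebra_simps)
  have ch: "qcnj h = of_real r - b * c"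
    using b c by (simp add: h_def r_def quat_eq_iff algebra_simps del: qcnj_simps)
  have 1: "c * h = r *\<^sub>R c + (M * M) *\<^sub>R b"
    unfolding h_def r_def[symmetric] right_diff_distrib mult.assoc[symmetric] cc
    by (simp add: of_real_def)
  have 2: "b * c * c = - (M * M) *\<^sub>R b"
    unfolding mult.assoc cc by (simp add: of_real_def)
  have 3: "b * c * b = - (2 * (b \<bullet> c)) *\<^sub>R b + (N * N) *\<^sub>R c"
    unfolding bc left_diff_distrib mult.assoc bb by (simp add: of_real_def)
  have "qcnj h * (c * h) = r *\<^sub>R (r *\<^sub>R c + (M * M) *\<^sub>R b) - (r *\<^sub>R (b * c * c) + (M * M) *\<^sub>R (b * c * b))"
    unfolding ch 1 by (simp add: algebra_simps of_real_def)
  also have "\<dots> = (r * r - (M * M) * (N * N)) *\<^sub>R c + (2 * (M * M) * (r + b \<bullet> c)) *\<^sub>R b"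
    unfolding 2 3 by (simp add: quat_eq_iff algebra_simps)
  also have "r * r - (M * M) * (N * N) = 0" by (simp add: r_def)
  finally show "qcnj h * c * h = (2 * (M * M) * (N * M + b \<bullet> c)) *\<^sub>R b"
    by (simp add: r_def mult.assoc)
  show "h \<bullet> c = 0"
    using b c by (simp add: h_def inner_quat_def algebra_simps)
qed

lemma bounded_bilinear_quat_mult: "bounded_bilinear ((*) :: quat \<Rightarrow> quat \<Rightarrow> quat)"
  unfolding bilinear_conv_bounded_bilinear[symmetric] bilinear_def
  by (intro conjI allI linearI) (simp_all add: algebra_simps)

lemmas smooth_on_quat_mult = smooth_on_bilinear[OF bounded_bilinear_quat_mult]

definition quat_of_vec :: "real^4 \<Rightarrow> quat" where
  "quat_of_vec x = Quat (x $ 1) (x $ 2) (x $ 3) (x $ 4)"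

lemma bounded_linear_quat_of_vec: "bounded_linear quat_of_vec"
  by (rule linear_conv_bounded_linear[THEN iffD1, OF linearI]) (simp_all add: quat_of_vec_def quat_eq_iff)

lemma quat_of_vec_eq_0: "quat_of_vec x = 0 \<longleftrightarrow> x = 0"
  by (auto simp: quat_of_vec_def quat_eq_iff vec_eq_iff forall_4)

lemma open_positive:
  fixes f :: "'a::topological_space \<Rightarrow> real"
  assumes "open U" "continuous_on U f"
  shows "open {x \<in> U. 0 < f x}"
  using continuous_open_preimage[OF assms(2,1) open_greaterThan[of 0]]
  by (simp add: vimage_def Int_def greaterThan_def conj_commute)

text \<open>Moving away from a point \<open>u\<close> of the zero level in horizontal directions, the moment map is
  corrected in one entry \<open>pr u \<noteq> 0\<close>, among the last two, by means of a section of the Hopf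
  map.\<close>

locale chart_slot = level_frame +
  fixes iota :: "quat \<Rightarrow> quat3" and pr :: "quat3 \<Rightarrow> quat"
  assumes slot: "(iota = (\<lambda>z. (0, z, 0)) \<and> pr = (\<lambda>Z. fst (snd Z))) \<or> (iota = (\<lambda>z. (0, 0, z)) \<and> pr = (\<lambda>Z. snd (snd Z)))"
    and pr_u: "pr u \<noteq> 0"
begin

definition "kappa Z = Z - iota (pr Z)"

lemma iota_simps:
  "iota (x + y) = iota x + iota y" "iota (x - y) = iota x - iota y" "iota (r *\<^sub>R x) = r *\<^sub>R iota x"
  "hdot (iota x) Z = qcnj x * pr Z" "hdot Z (iota x) = qcnj (pr Z) * x"
  "pr (iota x) = x" "D (iota x) = iota (real p *\<^sub>R (unit_j * x))"
  "pr (A + B) = pr A + pr B" "pr (A - B) = pr A - pr B" "pr (r *\<^sub>R A) = r *\<^sub>R pr A" "pr (rmult A h) = pr A * h"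
  "pr (D A) = real p *\<^sub>R (unit_j * pr A)" "iota 0 = 0"
  using slot by (auto simp: hdot_def circle_velocity_eq rmult_eq zero_prod_def)

lemma bounded_linear_iota: "bounded_linear iota"
  by (rule linear_conv_bounded_linear[THEN iffD1, OF linearI]) (simp_all add: iota_simps)

lemma bounded_linear_kappa: "bounded_linear kappa"
  by (rule linear_conv_bounded_linear[THEN iffD1, OF linearI]) (simp_all add: kappa_def iota_simps algebra_simps)

definition "a0 = pr u"
definition "N0 = a0 \<bullet> a0"
definition "eta0 = qcnj a0 * unit_j * a0"
definition "Y x = kappa (u + rmult w (quat_of_vec x))"
text \<open>A slot entry \<open>z\<close> adds p times \<open>qcnj z * unit_j * z\<close> to the
  moment, so \<open>eta x\<close> is the value this product must take.\<close>

definition "eta x = (- 1 / real p) *\<^sub>R hdot (Y x) (D (Y x))"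
definition "nrm x = sqrt (eta x \<bullet> eta x)"
definition "T x = nrm x * N0 + eta x \<bullet> eta0"
text \<open>The quaternion of \<open>quat_rotation\<close> that turns \<open>eta0\<close> towards
  \<open>eta x\<close>; the square root in \<open>zz\<close> cancels the scalar factor found
  there.\<close>

definition "rot x = of_real (nrm x * N0) - eta0 * eta x"
definition "zz x = (1 / sqrt (2 * (N0 * N0) * T x)) *\<^sub>R (a0 * rot x)"
definition "yy x = Y x + iota (zz x)"
definition "ss x = (1 / sqrt (yy x \<bullet> yy x)) *\<^sub>R yy x"
text \<open>The three domains keep roots and quotients smooth; \<open>T x > 0\<close> excludes
  \<open>eta x\<close> opposite to \<open>eta0\<close>.\<close>

definition "U1 = {x. 0 < eta x \<bullet> eta x}"
definition "U2 = {x \<in> U1. 0 < T x}"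
definition "U0 = {x \<in> U2. 0 < yy x \<bullet> yy x}"

lemma N0_pos: "N0 > 0"
  using pr_u by (simp add: N0_def a0_def)

lemma qre_eta0: "qre eta0 = 0"
  by (simp add: eta0_def quat_imaginary_iff mult.assoc)

lemma eta0_inner: "eta0 \<bullet> eta0 = N0 * N0"
  by (simp add: eta0_def quat_inner_self_mult inner_qcnj unit_j_inner N0_def)

lemma a0_eta0: "a0 * eta0 = N0 *\<^sub>R (unit_j * a0)"
  by (simp add: eta0_def mult.assoc[symmetric] qcnj_mult_self N0_def[symmetric]) (simp add: of_real_def)

lemma qre_eta: "qre (eta x) = 0"
proof -
  have "qcnj (hdot (Y x) (D (Y x))) = - hdot (Y x) (D (Y x))"
    by (metis hdot_commute hdot_circle_velocity)
  then show ?thesis by (simp add: eta_def quat_imaginary_iff)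
qed

lemma kappa_hdot: "hdot (iota z) (kappa Z) = 0" "hdot (kappa Z) (iota z) = 0"
  "hdot (iota z) (D (kappa Z)) = 0"
  "pr (kappa Z) = 0"
  by (simp_all add: kappa_def iota_simps circle_velocity_linear)

lemma pr_Y: "pr (Y x) = 0"
  by (simp add: Y_def kappa_hdot)

lemma smooth_Y: "smooth_on S Y" if "open S"
  unfolding Y_def[abs_def]
  by (intro smooth_on_bounded_linear[OF bounded_linear_kappa] smooth_on_add smooth_on_const
      smooth_on_bilinear[OF bounded_bilinear_rmult] smooth_on_linear_map[OF bounded_linear_quat_of_vec] that)

lemma smooth_eta: "smooth_on S eta" if "open S"
  unfolding eta_def[abs_def]
  by (intro smooth_on_scaleR smooth_on_const smooth_on_bilinear[OF bounded_bilinear_hdot]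
      smooth_on_bounded_linear[OF bounded_linear_circle_velocity] smooth_Y that)

lemma open_U1: "open U1"
  using open_positive[OF open_UNIV smooth_on_imp_continuous_on[OF smooth_on_inner[OF open_UNIV smooth_eta smooth_eta]]]
  by (simp add: U1_def)

lemma smooth_nrm: "smooth_on U1 nrm"
  unfolding nrm_def[abs_def]
  by (intro smooth_on_sqrt smooth_on_inner smooth_eta open_U1) (simp add: U1_def)

lemma smooth_T: "smooth_on U1 T"
  unfolding T_def[abs_def]
  by (intro smooth_on_add smooth_on_mult smooth_on_inner smooth_on_const smooth_eta smooth_nrm open_U1)

lemma open_U2: "open U2"
  unfolding U2_def by (intro open_positive open_U1 smooth_on_imp_continuous_on smooth_T)

lemma U2_U1: "U2 \<subseteq> U1" by (auto simp: U2_def)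

lemma smooth_zz: "smooth_on U2 zz"
proof -
  have r: "smooth_on U2 rot"
    unfolding rot_def[abs_def] of_real_def
    by (intro smooth_on_diff smooth_on_scaleR smooth_on_quat_mult smooth_on_mult smooth_on_const smooth_eta
        smooth_on_subset[OF smooth_nrm U2_U1] open_U2)
  show ?thesis
    unfolding zz_def[abs_def]
    by (intro smooth_on_scaleR smooth_on_divide smooth_on_sqrt smooth_on_quat_mult smooth_on_mult smooth_on_const r
        smooth_on_subset[OF smooth_T U2_U1] open_U2)
      (use N0_pos in \<open>auto simp: U2_def\<close>)
qed

lemma smooth_yy: "smooth_on U2 yy"
  unfolding yy_def[abs_def]
  by (intro smooth_on_add smooth_on_bounded_linear[OF bounded_linear_iota] smooth_Y smooth_zz open_U2)

lemma open_U0: "open U0"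
  unfolding U0_def by (intro open_positive open_U2 smooth_on_imp_continuous_on smooth_on_inner smooth_yy)

lemma U0_U2: "U0 \<subseteq> U2" by (auto simp: U0_def)

lemma smooth_scale: "smooth_on U0 (\<lambda>x. 1 / sqrt (yy x \<bullet> yy x))"
  by (intro smooth_on_divide smooth_on_sqrt smooth_on_inner smooth_on_const
      smooth_on_subset[OF smooth_yy U0_U2] open_U0) (auto simp: U0_def)

lemma smooth_ss: "smooth_on U0 ss"
  unfolding ss_def[abs_def]
  by (intro smooth_on_scaleR smooth_scale smooth_on_subset[OF smooth_yy U0_U2] open_U0)

lemma zz_hopf:
  assumes "x \<in> U2"
  shows "qcnj (zz x) * (unit_j * zz x) = eta x"
proof -
  have n: "nrm x * nrm x = eta x \<bullet> eta x" by (simp add: nrm_def)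
  have t: "T x > 0" using assms by (simp add: U2_def)
  define k where "k = 2 * (N0 * N0) * T x"
  have k: "k > 0" using t N0_pos by (simp add: k_def)
  have "qcnj (zz x) * (unit_j * zz x) = (1 / sqrt k * (1 / sqrt k)) *\<^sub>R (qcnj (rot x) * eta0 * rot x)"
    by (simp add: zz_def k_def eta0_def mult.assoc)
  also have "qcnj (rot x) * eta0 * rot x = k *\<^sub>R eta x"
    using quat_rotation(1)[OF qre_eta[of x] qre_eta0 n eta0_inner[symmetric]]
    by (simp add: rot_def k_def T_def)
  finally show ?thesis using k by simp
qed

text \<open>The section is orthogonal to the circle direction \<open>j a0\<close>, which makes the chart transverse to the
  circle orbits.\<close>

lemma zz_gauge: "zz x \<bullet> (unit_j * a0) = 0"
proof -
  have "(a0 * rot x) \<bullet> (N0 *\<^sub>R (unit_j * a0)) = (a0 * rot x) \<bullet> (a0 * eta0)"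
    by (simp add: a0_eta0)
  also have "\<dots> = N0 * (rot x \<bullet> eta0)"
    by (simp add: quat_inner_mult_left(1) mult.assoc[symmetric] qcnj_mult_self N0_def[symmetric]) (simp add: of_real_def)
  also have "rot x \<bullet> eta0 = 0"
    using quat_rotation(2)[OF qre_eta[of x] qre_eta0 _ eta0_inner[symmetric], of "nrm x"]
    by (simp add: rot_def nrm_def)
  finally show ?thesis using N0_pos by (simp add: zz_def)
qed

lemma yy_level: "x \<in> U2 \<Longrightarrow> hdot (yy x) (D (yy x)) = 0"
  using pq zz_hopf[of x]
  by (simp add: yy_def hdot_simps circle_velocity_linear iota_simps pr_Y eta_def)

lemma ss_level: "x \<in> U0 \<Longrightarrow> ss x \<in> level p q"
proof -
  assume x: "x \<in> U0"
  then have "yy x \<bullet> yy x > 0" by (simp add: U0_def)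
  moreover have "hdot (yy x) (D (yy x)) = 0" using x U0_U2 yy_level by blast
  ultimately show ?thesis
    by (simp add: level_def sphere11_iff moment_eq_hdot ss_def circle_velocity_linear hdot_simps)
qed

lemma at_0: "eta 0 = eta0" "nrm 0 = N0" "T 0 = 2 * (N0 * N0)" "zz 0 = a0" "yy 0 = u" "ss 0 = u" "0 \<in> U0"
proof -
  have Y0: "Y 0 = kappa u" by (simp add: Y_def quat_of_vec_eq_0[THEN iffD2] rmult_0)
  have u_eq: "u = kappa u + iota a0" by (simp add: kappa_def a0_def)
  have "0 = hdot (kappa u + iota a0) (D (kappa u + iota a0))" using uDu u_eq by simp
  also have "\<dots> = hdot (kappa u) (D (kappa u)) + real p *\<^sub>R eta0"
    by (simp add: hdot_simps circle_velocity_linear kappa_hdot iota_simps)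
      (simp add: kappa_def iota_simps eta0_def mult.assoc)
  finally have "hdot (kappa u) (D (kappa u)) = - (real p *\<^sub>R eta0)" by (simp add: eq_neg_iff_add_eq_0)
  then show e: "eta 0 = eta0" using pq by (simp add: eta_def Y0)
  show n: "nrm 0 = N0" using N0_pos by (simp add: nrm_def e eta0_inner)
  show T: "T 0 = 2 * (N0 * N0)" by (simp add: T_def e n eta0_inner)
  \<comment> \<open>An imaginary quaternion has a real square, so \<open>rot 0\<close> is real and
    \<open>zz 0\<close> is a positive multiple of \<open>a0\<close>.\<close>
  have "eta0 * eta0 = - of_real (N0 * N0)"
    unfolding eta0_inner[symmetric] using qre_eta0 by (simp add: quat_eq_iff inner_quat_def)
  then have "rot 0 = (2 * (N0 * N0)) *\<^sub>R 1"
    by (simp add: rot_def e n of_real_def flip: scaleR_add_left del: of_real_mult)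
  moreover have "sqrt (2 * (N0 * N0) * T 0) = 2 * (N0 * N0)"
    using real_sqrt_abs[of "2 * (N0 * N0)"] N0_pos by (simp add: T power2_eq_square)
  ultimately show z: "zz 0 = a0" using N0_pos by (simp add: zz_def)
  show y: "yy 0 = u" using u_eq by (simp add: yy_def Y0 z)
  show "ss 0 = u" by (simp add: ss_def y uu)
  show "0 \<in> U0" using N0_pos by (simp add: U0_def U2_def U1_def e T y uu eta0_inner del: inner_gt_zero_iff)
qed

text \<open>A direction without horizontal part moves \<open>yy\<close> by \<open>rmult u f\<close>
  plus a multiple of \<open>D u\<close>. The difference \<open>B\<close> from the intended motion
  along \<open>w\<close> then lives in the slot alone; its components along \<open>u\<close> and
  \<open>D u\<close> leave one real unknown \<open>\<rho>\<close>, which \<open>zz_gauge\<close>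
  determines.\<close>

lemma ss_independent:
  assumes h: "orbifold_horizontal p q (ss 0) (frechet_derivative ss (at 0) v) = 0"
  shows "v = 0"
proof -
  define t where "t = frechet_derivative ss (at 0) v"
  define dz where "dz = frechet_derivative zz (at 0) v"
  have zd: "(zz has_derivative frechet_derivative zz (at 0)) (at 0)"
    using smooth_on_has_derivative[OF smooth_zz] at_0(7) U0_U2 by blast
  have gauge: "dz \<bullet> (unit_j * a0) = 0"
  proof -
    have "((\<lambda>x. zz x \<bullet> (unit_j * a0)) has_derivative (\<lambda>v. frechet_derivative zz (at 0) v \<bullet> (unit_j * a0))) (at 0)"
      by (rule bounded_linear.has_derivative[OF bounded_linear_inner_left zd])
    then have "((\<lambda>x. 0 :: real) has_derivative (\<lambda>v. frechet_derivative zz (at 0) v \<bullet> (unit_j * a0))) (at 0)"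
      by (simp add: zz_gauge)
    from has_derivative_unique[OF this has_derivative_const] show ?thesis
      unfolding dz_def by (metis)
  qed
  have Yd: "(Y has_derivative (\<lambda>x. kappa (0 + rmult w (quat_of_vec x)))) (at 0)"
    unfolding Y_def[abs_def]
    by (intro bounded_linear.has_derivative[OF bounded_linear_kappa] has_derivative_add has_derivative_const
        bounded_linear_imp_has_derivative bounded_linear_compose[OF bounded_bilinear.bounded_linear_right[OF bounded_bilinear_rmult] bounded_linear_quat_of_vec])
  have yd: "(yy has_derivative (\<lambda>x. kappa (0 + rmult w (quat_of_vec x)) + iota (frechet_derivative zz (at 0) x))) (at 0)"
    unfolding yy_def[abs_def]
    by (intro has_derivative_add Yd bounded_linear.has_derivative[OF bounded_linear_iota zd])
  define c where "c x = 1 / sqrt (yy x \<bullet> yy x)" for x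
  have cd: "(c has_derivative frechet_derivative c (at 0)) (at 0)"
    using smooth_on_has_derivative[OF smooth_scale at_0(7)] by (simp add: c_def[abs_def])
  have c0: "c 0 = 1" by (simp add: c_def at_0 uu)
  have "(ss has_derivative (\<lambda>x. c 0 *\<^sub>R (kappa (0 + rmult w (quat_of_vec x)) + iota (frechet_derivative zz (at 0) x))
      + frechet_derivative c (at 0) x *\<^sub>R yy 0)) (at 0)"
    unfolding ss_def[abs_def] c_def[symmetric] by (rule has_derivative_scaleR[OF cd yd])
  from frechet_derivative_at[OF this]
  have t: "t = kappa (rmult w (quat_of_vec v)) + iota dz + frechet_derivative c (at 0) v *\<^sub>R u"
    unfolding t_def by (metis (no_types, lifting) c0 at_0(5) dz_def add_0 scaleR_one)
  define g where "g = D u \<bullet> t / nu2"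
  \<comment> \<open>The derivative of the normalizing factor points along \<open>u\<close> and is
    absorbed into this coefficient.\<close>
  define f where "f = hdot u t - of_real (u \<bullet> t) - of_real (frechet_derivative c (at 0) v)"
  have "t = rmult u (hdot u t - of_real (u \<bullet> t)) + g *\<^sub>R D u"
    using h unfolding at_0(6) t_def[symmetric] orbifold_horizontal_eq g_def by (simp add: algebra_simps)
  then have eq: "kappa (rmult w (quat_of_vec v)) + iota dz = rmult u f + g *\<^sub>R D u"
  proof -
    have "kappa (rmult w (quat_of_vec v)) + iota dz = t - frechet_derivative c (at 0) v *\<^sub>R u"
      by (simp add: t)
    moreover have "rmult u f = rmult u (hdot u t - of_real (u \<bullet> t)) - frechet_derivative c (at 0) v *\<^sub>R u"
      by (simp add: f_def rmult_diff rmult_of_real)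
    ultimately show ?thesis
      using \<open>t = rmult u (hdot u t - of_real (u \<bullet> t)) + g *\<^sub>R D u\<close> by (metis add_diff_eq diff_add_eq)
  qed
  define B where "B = rmult w (quat_of_vec v) - rmult u f - g *\<^sub>R D u"
  define \<zeta> where "\<zeta> = pr B"
  have slot_eq: "dz = a0 * f + (g * real p) *\<^sub>R (unit_j * a0)"
    using arg_cong[OF eq, of pr] by (simp add: iota_simps kappa_hdot a0_def)
  have "kappa B = 0"
  proof -
    have "kappa (kappa Z) = kappa Z" "kappa (iota z) = 0" for Z z
      by (simp_all add: kappa_def iota_simps)
    note k = this
    have "kappa (kappa (rmult w (quat_of_vec v)) + iota dz) = kappa (rmult u f + g *\<^sub>R D u)"
      by (simp add: eq)
    then show ?thesis
      using linear_simps[OF bounded_linear_kappa] by (simp add: B_def k)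
  qed
  then have B: "B = iota \<zeta>" by (simp add: kappa_def \<zeta>_def)
  have f: "f = - (qcnj a0 * \<zeta>)"
  proof -
    have "hdot u B = - f" by (simp add: B_def hdot_simps uu uDu horizD[OF w(1)])
    then show ?thesis unfolding B iota_simps a0_def by (metis minus_minus)
  qed
  have "hdot (D u) B = - of_real (g * nu2)"
    by (simp add: B_def hdot_simps uDu DuDu horizD[OF w(1)]) (simp add: of_real_def)
  moreover have "hdot (D u) (iota \<zeta>) = - (real p *\<^sub>R (qcnj a0 * (unit_j * \<zeta>)))"
    by (simp add: iota_simps a0_def mult.assoc)
  ultimately have g: "real p *\<^sub>R (qcnj a0 * (unit_j * \<zeta>)) = of_real (g * nu2)" by (simp add: B)
  define \<rho> where "\<rho> = - (g * nu2 / (real p * N0))"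
  have jj: "unit_j * (unit_j * b) = - b" for b by (simp add: quat_eq_iff)
  have "(real p * N0) *\<^sub>R (unit_j * \<zeta>) = a0 * of_real (g * nu2)"
  proof -
    have "a0 * (real p *\<^sub>R (qcnj a0 * (unit_j * \<zeta>))) = real p *\<^sub>R ((a0 * qcnj a0) * (unit_j * \<zeta>))"
      by (simp add: mult.assoc)
    also have "\<dots> = (real p * N0) *\<^sub>R (unit_j * \<zeta>)"
      by (simp add: qcnj_mult_self N0_def[symmetric]) (simp add: of_real_def)
    finally show ?thesis unfolding g by simp
  qed
  then have "unit_j * ((real p * N0) *\<^sub>R (unit_j * \<zeta>)) = unit_j * ((g * nu2) *\<^sub>R a0)"
    by (simp add: of_real_def)
  then have "- ((real p * N0) *\<^sub>R \<zeta>) = (g * nu2) *\<^sub>R (unit_j * a0)" by (simp add: jj)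
  then have "(real p * N0) *\<^sub>R \<zeta> = - ((g * nu2) *\<^sub>R (unit_j * a0))" by (metis minus_minus)
  also have "\<dots> = (real p * N0) *\<^sub>R (\<rho> *\<^sub>R (unit_j * a0))"
    using pq N0_pos by (simp add: \<rho>_def)
  finally have \<zeta>: "\<zeta> = \<rho> *\<^sub>R (unit_j * a0)"
    by (rule scaleR_left_imp_eq[rotated]) (use pq N0_pos in simp)
  have gr: "g = - (\<rho> * real p * N0 / nu2)" using pq N0_pos nu2_pos by (simp add: \<rho>_def field_simps)
  have "0 = dz \<bullet> (unit_j * a0)" using gauge by simp
  also have "\<dots> = - \<rho> * (N0 * N0) + g * real p * N0"
  proof -
    have "a0 * f = - (\<rho> * N0) *\<^sub>R (unit_j * a0)"
      unfolding f \<zeta> by (simp add: mult.assoc[symmetric] qcnj_mult_self N0_def[symmetric]) (simp add: of_real_def)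
    then show ?thesis
      unfolding slot_eq by (simp add: inner_add_left inner_diff_left unit_j_mult_inner N0_def)
  qed
  \<comment> \<open>Both contributions have the same sign, so the gauge condition forces
    \<open>\<rho> = 0\<close>.\<close>
  also have "\<dots> = - \<rho> * (N0 * (N0 + (real p)\<^sup>2 * N0 / nu2))"
    unfolding gr by (simp add: algebra_simps power2_eq_square)
  finally have "\<rho> * (N0 * (N0 + (real p)\<^sup>2 * N0 / nu2)) = 0" by simp
  moreover have "N0 * (N0 + (real p)\<^sup>2 * N0 / nu2) > 0"
    using N0_pos nu2_pos pq by (intro mult_pos_pos add_pos_pos divide_pos_pos) auto
  ultimately have "\<rho> = 0" by (metis less_irrefl mult_eq_0_iff)
  then have "B = 0" using B \<zeta> by (simp add: iota_simps)
  moreover have "hdot w B = quat_of_vec v"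
    by (simp add: B_def hdot_simps ww horizD[OF w(1)])
  ultimately have "quat_of_vec v = 0" by (simp add: hdot_zero)
  then show ?thesis by (simp add: quat_of_vec_eq_0)
qed

lemma exists_chart_slot: "\<exists>V r. orbifold_chart p q V r \<and> 0 \<in> V \<and> r 0 = u"
proof -
  interpret m: level_map p q U0 ss
    by unfold_locales (use pq open_U0 smooth_ss ss_level in auto)
  \<comment> \<open>Transversality is known at 0 only and persists where the Gram determinant is
    nonzero; the square makes this an open positivity condition.\<close>
  define V where "V = {x \<in> U0. 0 < (det (m.met x))\<^sup>2}"
  have sm: "smooth_on U0 (\<lambda>x. (det (m.met x))\<^sup>2)"
    unfolding power2_eq_square by (intro smooth_on_mult smooth_on_det m.smooth_met open_U0)
  have "open V" unfolding V_def by (intro open_positive open_U0 smooth_on_imp_continuous_on sm)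
  have VU: "V \<subseteq> U0" by (auto simp: V_def)
  have "orbifold_chart p q V ss"
    unfolding orbifold_chart_def
  proof (intro conjI ballI allI impI)
    show "open V" by fact
    show "smooth_on V ss" by (rule smooth_on_subset[OF smooth_ss VU])
    fix x assume x: "x \<in> V"
    then have x0: "x \<in> U0" using VU by blast
    then show "ss x \<in> sphere11" "moment p q (ss x) = 0" using ss_level by (auto simp: level_def)
    fix v assume "orbifold_horizontal p q (ss x) (frechet_derivative ss (at x) v) = 0"
    then have "m.lift x v = 0" by (simp add: m.orbifold_horizontal_derivative[OF x0])
    moreover have "det (m.met x) \<noteq> 0" using x by (simp add: V_def)
    ultimately show "v = 0" using m.det_met_iff[OF x0] by blast
  qed
  moreover have "det (m.met 0) \<noteq> 0"
    using m.det_met_iff[OF at_0(7)] m.orbifold_horizontal_derivative[OF at_0(7)] ss_independent by simp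
  then have "0 \<in> V" using at_0(7) by (simp add: V_def)
  ultimately show ?thesis using at_0(6) by blast
qed

end

lemma (in level_point) exists_chart: "\<exists>V r. orbifold_chart p q V r \<and> 0 \<in> V \<and> r 0 = u"
proof -
  obtain w where w: "w \<in> horiz" "w \<bullet> w = 1" by (rule exists_unit_horiz)
  \<comment> \<open>Otherwise \<open>fst u\<close> would have norm 1 and \<open>level_bound\<close>
    would give \<open>q \<le> 0\<close>.\<close>
  have "fst (snd u) \<noteq> 0 \<or> snd (snd u) \<noteq> 0"
  proof (rule ccontr)
    assume "\<not> ?thesis"
    then have "fst u \<bullet> fst u = 1" using uu(1) by (simp add: inner_quat3)
    then show False using level_bound pq by simp
  qed
  then show ?thesis
  proof
    assume "fst (snd u) \<noteq> 0"
    then interpret chart_slot p q u w "\<lambda>z. (0, z, 0)" "\<lambda>Z. fst (snd Z)"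
      by unfold_locales (use w in auto)
    show ?thesis by (rule exists_chart_slot)
  next
    assume "snd (snd u) \<noteq> 0"
    then interpret chart_slot p q u w "\<lambda>z. (0, 0, z)" "\<lambda>Z. snd (snd Z)"
      by unfold_locales (use w in auto)
    show ?thesis by (rule exists_chart_slot)
  qed
qed

section \<open>The pinching constant\<close>

lemma orbifold_chart_level_chart:
  assumes pq: "p > 0" "q > 0" and chart: "orbifold_chart p q V r"
  shows "level_chart p q V r"
proof -
  interpret level_map p q V r
    by unfold_locales (use pq chart in \<open>auto simp: orbifold_chart_def level_def\<close>)
  show ?thesis
  proof unfold_locales
    fix x v assume x: "x \<in> V" and "(\<Sum>i\<in>UNIV. v $ i *\<^sub>R e i x) = 0"
    then have "orbifold_horizontal p q (r x) (frechet_derivative r (at x) v) = 0"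
      by (simp add: orbifold_horizontal_derivative[OF x])
    then show "v = 0" using chart x by (simp add: orbifold_chart_def)
  qed
qed

text \<open>The equality case of Cauchy-Schwarz.\<close>

lemma gram_eq_0:
  assumes "gram X Y = 0"
  shows "(Y \<bullet> Y) *\<^sub>R X = (X \<bullet> Y) *\<^sub>R Y"
proof -
  define Z where "Z = (Y \<bullet> Y) *\<^sub>R X - (X \<bullet> Y) *\<^sub>R Y"
  have "Z \<bullet> Z = (Y \<bullet> Y) * gram X Y"
    by (simp add: Z_def gram_def inner_diff_left inner_diff_right power2_eq_square inner_commute[of Y X] algebra_simps)
  then show ?thesis using assms by (simp add: Z_def)
qed

lemma gram_nonneg: "gram X Y \<ge> 0"
  using Cauchy_Schwarz_ineq[of X Y] by (simp add: gram_def)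

lemma gram_scaleR_right [simp]: "gram (k *\<^sub>R Y) Y = 0"
  by (simp add: gram_def power2_eq_square)

lemma gram_zero [simp]: "gram X 0 = 0" by (simp add: gram_def)

context level_chart
begin

context
  fixes x assumes x: "x \<in> U"
begin

interpretation lp: level_point p q "s x" by (rule level_point[OF x])

lemma linear_lift: "linear (lift x)"
  by (rule linearI) (simp_all add: scaleR_add_left sum.distrib scaleR_sum_right)

lemma gram_lift_iff: "gram (lift x v) (lift x w) > 0 \<longleftrightarrow> v \<noteq> w \<and> Real_Vector_Spaces.independent {v, w}"
proof
  assume g: "gram (lift x v) (lift x w) > 0"
  have vw: "v \<noteq> k *\<^sub>R w" for k
    using g linear_cmul[OF linear_lift, of k w] by auto
  moreover have "w \<noteq> 0" using g linear_0[OF linear_lift] by auto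
  ultimately have "Real_Vector_Spaces.independent {v, w}"
    by (simp add: independent_insert span_singleton image_iff)
  then show "v \<noteq> w \<and> Real_Vector_Spaces.independent {v, w}" using vw[of 1] by simp
next
  assume vw: "v \<noteq> w \<and> Real_Vector_Spaces.independent {v, w}"
  show "gram (lift x v) (lift x w) > 0"
  proof (rule ccontr)
    assume "\<not> ?thesis"
    then have "gram (lift x v) (lift x w) = 0" using gram_nonneg[of "lift x v" "lift x w"] by linarith
    from gram_eq_0[OF this]
    have "lift x ((lift x w \<bullet> lift x w) *\<^sub>R v - (lift x v \<bullet> lift x w) *\<^sub>R w) = 0"
      unfolding linear_diff[OF linear_lift] linear_cmul[OF linear_lift] by simp
    from independent[OF x this]
    have eq: "(lift x w \<bullet> lift x w) *\<^sub>R v = (lift x v \<bullet> lift x w) *\<^sub>R w" by simp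
    have "w \<noteq> 0" using vw dependent_zero[of "{v, w}"] by auto
    then have "lift x w \<noteq> 0" using independent[OF x, of w] by auto
    then have "v = ((lift x v \<bullet> lift x w) / (lift x w \<bullet> lift x w)) *\<^sub>R w"
      using arg_cong[OF eq, of "\<lambda>z. (1 / (lift x w \<bullet> lift x w)) *\<^sub>R z"] by simp
    then have "v \<in> span {w}" unfolding span_singleton by (rule range_eqI)
    then show False using vw by (simp add: independent_insert)
  qed
qed

lemma sectional_curvature_bounds:
  assumes "v \<noteq> w" "Real_Vector_Spaces.independent {v, w}"
  shows "4 - 2 * lp.lam \<le> sectional_curvature met x v w" "sectional_curvature met x v w \<le> 4 + 4 * lp.lam"
proof -
  obtain w0 where w0: "w0 \<in> lp.horiz" "w0 \<bullet> w0 = 1" by (rule lp.exists_unit_horiz)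
  interpret lf: level_frame p q "s x" w0 by unfold_locales (use w0 in auto)
  define X where "X = lift x v"
  define Y where "Y = lift x w"
  have h: "X \<in> lp.horiz" "Y \<in> lp.horiz" unfolding X_def Y_def by (rule lift_horiz[OF x])+
  have g: "gram X Y > 0" unfolding X_def Y_def gram_lift_iff using assms by simp
  define t where "t = (D X \<bullet> Y)\<^sup>2 / lp.nu2"
  have t: "0 \<le> t" "t \<le> lp.lam * gram X Y"
    using lf.curv_formula(2)[OF h] lp.nu2_pos by (simp_all add: t_def)
  have K: "sectional_curvature met x v w = ((4 - 2 * lp.lam) * gram X Y + 6 * t) / gram X Y"
    unfolding sectional_curvature_eq[OF x] X_def[symmetric] Y_def[symmetric] lf.curv_formula(1)[OF h] t_def by simp
  show "4 - 2 * lp.lam \<le> sectional_curvature met x v w"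
    unfolding K using g t by (simp add: pos_le_divide_eq)
  show "sectional_curvature met x v w \<le> 4 + 4 * lp.lam"
    unfolding K using g t by (simp add: pos_divide_le_eq) (simp add: algebra_simps)
qed

lemma sectional_curvature_attained:
  shows "\<exists>v w. v \<noteq> w \<and> Real_Vector_Spaces.independent {v, w} \<and> sectional_curvature met x v w = 4 - 2 * lp.lam"
    and "\<exists>v w. v \<noteq> w \<and> Real_Vector_Spaces.independent {v, w} \<and> sectional_curvature met x v w = 4 + 4 * lp.lam"
proof -
  obtain w0 where w0: "w0 \<in> lp.horiz" "w0 \<bullet> w0 = 1" by (rule lp.exists_unit_horiz)
  interpret lf: level_frame p q "s x" w0 by unfold_locales (use w0 in auto)
  obtain X Y where XY: "X \<in> lp.horiz" "Y \<in> lp.horiz" "gram X Y = 1" "(D X \<bullet> Y)\<^sup>2 / lp.nu2 = lp.lam"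
    "\<exists>Z \<in> lp.horiz. gram X Z = 1 \<and> D X \<bullet> Z = 0"
    by (rule lf.curv_extremal)
  then obtain Z where Z: "Z \<in> lp.horiz" "gram X Z = 1" "D X \<bullet> Z = 0" by blast
  obtain v where v: "X = lift x v" using lift_surj[OF x XY(1)] .
  obtain w where w: "Y = lift x w" using lift_surj[OF x XY(2)] .
  obtain z where z: "Z = lift x z" using lift_surj[OF x Z(1)] .
  have K: "sectional_curvature met x v b = (4 - 2 * lp.lam) + 6 * ((D X \<bullet> B)\<^sup>2 / lp.nu2)"
    if "B = lift x b" "gram X B = 1" "B \<in> lp.horiz" for b B
    unfolding sectional_curvature_eq[OF x] that(1)[symmetric] v[symmetric] lf.curv_formula(1)[OF XY(1) that(3)] that(2)
    by simp
  have "sectional_curvature met x v z = 4 - 2 * lp.lam"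
    using K[OF z Z(2,1)] Z(3) by simp
  moreover have "v \<noteq> z \<and> Real_Vector_Spaces.independent {v, z}"
    using gram_lift_iff[of v z] Z(2) v z by simp
  ultimately show "\<exists>v w. v \<noteq> w \<and> Real_Vector_Spaces.independent {v, w} \<and> sectional_curvature met x v w = 4 - 2 * lp.lam"
    by blast
  have "sectional_curvature met x v w = 4 + 4 * lp.lam"
    using K[OF w XY(3,2)] XY(4) by simp
  moreover have "v \<noteq> w \<and> Real_Vector_Spaces.independent {v, w}"
    using gram_lift_iff[of v w] XY(3) v w by simp
  ultimately show "\<exists>v w. v \<noteq> w \<and> Real_Vector_Spaces.independent {v, w} \<and> sectional_curvature met x v w = 4 + 4 * lp.lam"
    by blast
qed

end

end

lemma sectional_curvatures_atI:
  "orbifold_chart p q V r \<Longrightarrow> x \<in> V \<Longrightarrow> circle_orbit p q (hp_class (r x)) = P \<Longrightarrow> v \<noteq> w \<Longrightarrow>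
    independent {v, w} \<Longrightarrow> sectional_curvature (orbifold_metric p q r) x v w \<in> sectional_curvatures_at p q P"
  unfolding sectional_curvatures_at_def by blast

text \<open>The extremes are attained in the chart from \<open>exists_chart\<close>, while the
  bounds are verified in every chart through \<open>P\<close>.\<close>

lemma (in level_point) pinching_eq:
  assumes P: "P = circle_orbit p q (hp_class u)"
  shows "pinching p q P = (4 - 2 * lam) / (4 + 4 * lam)"
proof -
  let ?S = "sectional_curvatures_at p q P"
  obtain V r where r: "orbifold_chart p q V r" "0 \<in> V" "r 0 = u" using exists_chart by blast
  interpret c: level_chart p q V r by (rule orbifold_chart_level_chart[OF pq r(1)])
  have orb: "circle_orbit p q (hp_class (r 0)) = P" by (simp add: r P)
  have mem: "4 - 2 * lam \<in> ?S" "4 + 4 * lam \<in> ?S"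
    using c.sectional_curvature_attained[OF r(2), unfolded r(3)] sectional_curvatures_atI[OF r(1,2) orb] by metis+
  have bounds: "4 - 2 * lam \<le> K \<and> K \<le> 4 + 4 * lam" if K: "K \<in> ?S" for K
  proof -
    obtain W t x v w where t: "orbifold_chart p q W t" "x \<in> W" "circle_orbit p q (hp_class (t x)) = P"
      and vw: "v \<noteq> w" "independent {v, w}" and K: "K = sectional_curvature (orbifold_metric p q t) x v w"
      using K unfolding sectional_curvatures_at_def by blast
    interpret d: level_chart p q W t by (rule orbifold_chart_level_chart[OF pq t(1)])
    interpret l: level_point p q "t x" by (rule d.level_point[OF t(2)])
    \<comment> \<open>Another chart may pass through a different lift of the orbit; the invariance
      of the first norm gives it the same \<open>lam\<close>.\<close>
    have "t x \<in> \<Union> (circle_orbit p q (hp_class u))"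
      using circle_orbit_self[of "t x" p q] t(3) P by simp
    then have "fst (t x) \<bullet> fst (t x) = fst u \<bullet> fst u" by (rule circle_orbit_fst)
    then have "l.lam = lam" by (simp add: l.lam_def lam_def l.nu2_eq nu2_eq)
    then show ?thesis using d.sectional_curvature_bounds[OF t(2) vw] K by simp
  qed
  have "(LEAST K. K \<in> ?S) = 4 - 2 * lam"
    by (rule Least_equality) (use mem bounds in auto)
  moreover have "(GREATEST K. K \<in> ?S) = 4 + 4 * lam"
    by (rule Greatest_equality) (use mem bounds in auto)
  ultimately show ?thesis by (simp add: pinching_def)
qed

section \<open>The pinching constant as a function of \<open>lam\<close>\<close>

definition "pinch l = (4 - 2 * l) / (4 + 4 * l)" for l :: real

lemma pinch_antimono: "0 \<le> l \<Longrightarrow> l \<le> m \<Longrightarrow> pinch m \<le> pinch l"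
  by (simp add: pinch_def frac_le_eq divide_le_0_iff) (simp add: algebra_simps)

text \<open>At \<open>q^2 / p^2\<close> and \<open>p^4 / q^4\<close> this yields the bounds of the
  theorem.\<close>

lemma pinch_quotient: "a > 0 \<Longrightarrow> b > 0 \<Longrightarrow> pinch (a / b) = 1/4 + 3/4 * ((b - a) / (b + a))"
  by (simp add: pinch_def divide_simps) (simp add: algebra_simps)

lemma pinch_eq_quarter: "0 \<le> l \<Longrightarrow> pinch l = 1/4 \<longleftrightarrow> l = 1"
  by (simp add: pinch_def divide_simps)

lemma pinch_near_quarter: "0 \<le> l \<Longrightarrow> \<bar>pinch l - 1/4\<bar> \<le> \<bar>l - 1\<bar>"
proof -
  assume l: "0 \<le> l"
  have "pinch l - 1/4 = (3/4) * (1 - l) / (1 + l)"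
    using l by (simp add: pinch_def divide_simps) (simp add: algebra_simps)
  then have "\<bar>pinch l - 1/4\<bar> = (3/4) * \<bar>1 - l\<bar> / (1 + l)"
    using l by (simp only: abs_divide abs_mult)
  also have "\<dots> \<le> \<bar>1 - l\<bar> / 1"
    using l by (intro frac_le) auto
  finally show ?thesis by (simp add: abs_minus_commute)
qed

lemma GL_orbifold_point:
  assumes "P \<in> GL_orbifold p q"
  obtains u where "u \<in> level p q" "P = circle_orbit p q (hp_class u)"
  using assms by (auto simp: GL_orbifold_def LH_def level_def)

text \<open>The inequalities between \<open>p^2\<close> and \<open>q^2\<close> enter through
  \<open>l < 2\<close>, which makes the minimal curvature positive.\<close>

lemma admissible_lam:
  assumes adm: "admissible p q" and P: "P \<in> GL_orbifold p q"
  shows "\<exists>l. pinching p q P = pinch l \<and> 0 < l \<and> l < 2 \<and>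
    (p \<le> q \<longrightarrow> real p / real q \<le> l \<and> l \<le> (real q)\<^sup>2 / (real p)\<^sup>2) \<and>
    (q \<le> p \<longrightarrow> (real q)\<^sup>2 / (real p)\<^sup>2 \<le> l \<and> l \<le> real p / real q)"
proof -
  have pq: "p > 0" "q > 0" using adm by (auto simp: admissible_def)
  obtain u where lev: "u \<in> level p q" and orb: "P = circle_orbit p q (hp_class u)" using GL_orbifold_point[OF P] .
  interpret level_point p q u by unfold_locales (use pq lev in auto)
  have "lam < 2"
  proof (cases "p \<le> q")
    case True
    have "(real q)\<^sup>2 < 2 * (real p)\<^sup>2"
      using adm by (simp add: admissible_def)
    then have "(real q)\<^sup>2 / (real p)\<^sup>2 < 2" using pq by (simp add: divide_simps)
    then show ?thesis using lam_bounds(2)[OF True] by simp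
  next
    case False
    then have le: "q \<le> p" by simp
    have "(real p)\<^sup>2 < sqrt 2 * (real q)\<^sup>2" using adm by (simp add: admissible_def)
    also have "\<dots> \<le> 2 * (real q)\<^sup>2"
      using real_sqrt_le_mono[of 2 4] by (intro mult_right_mono) auto
    finally have "(real p)\<^sup>2 < 2 * (real q)\<^sup>2" .
    also have "\<dots> \<le> (2 * real q)\<^sup>2" by (simp add: power_mult_distrib)
    finally have "real p < 2 * real q" by (rule power2_less_imp_less) simp
    then have "real p / real q < 2" using pq by (simp add: divide_simps)
    then show ?thesis using lam_bounds(4)[OF le] by simp
  qed
  then show ?thesis
    using pinching_eq[OF orb] lam_pos lam_bounds by (intro exI[of _ lam]) (simp add: pinch_def)
qed

theorem lemma6p2p1:
  shows
    "(\<forall>p q. admissible p q \<longrightarrow> (\<forall>P\<in>GL_orbifold p q.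
        0 < pinching p q P \<and> pinching p q P < 1 \<and>
        (p \<le> q \<longrightarrow>
          1/4 - 3/4 * (((real q)^2 - (real p)^2) / ((real p)^2 + (real q)^2)) \<le> pinching p q P \<and>
          pinching p q P \<le> 1/4 + 3/4 * (((real q)^4 - (real p)^4) / ((real p)^4 + (real q)^4))) \<and>
        (p \<ge> q \<longrightarrow>
          1/4 - 3/4 * (((real p)^4 - (real q)^4) / ((real p)^4 + (real q)^4)) \<le> pinching p q P \<and>
          pinching p q P \<le> 1/4 + 3/4 * (((real p)^2 - (real q)^2) / ((real p)^2 + (real q)^2)))))
     \<and> (\<forall>\<epsilon>>0. \<exists>\<delta>>0. \<forall>p q. admissible p q \<and> \<bar>real p / real q - 1\<bar> < \<delta> \<longrightarrow>
          (\<forall>P\<in>GL_orbifold p q. \<bar>pinching p q P - 1/4\<bar> < \<epsilon>))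
     \<and> (\<forall>p q. admissible p q \<longrightarrow>
          ((\<forall>P\<in>GL_orbifold p q. pinching p q P = 1/4) \<longleftrightarrow> p = 1 \<and> q = 1))"
proof (intro conjI allI impI ballI)
  fix p q P assume adm: "admissible p q" and P: "P \<in> GL_orbifold p q"
  obtain l where k: "pinching p q P = pinch l" and l: "0 < l" "l < 2"
    and b1: "p \<le> q \<Longrightarrow> real p / real q \<le> l" "p \<le> q \<Longrightarrow> l \<le> (real q)\<^sup>2 / (real p)\<^sup>2"
    and b2: "q \<le> p \<Longrightarrow> (real q)\<^sup>2 / (real p)\<^sup>2 \<le> l" "q \<le> p \<Longrightarrow> l \<le> real p / real q"
    using admissible_lam[OF adm P] by blast
  have pq: "real p > 0" "real q > 0" using adm by (auto simp: admissible_def)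
  show "0 < pinching p q P" using l by (simp add: k pinch_def)
  show "pinching p q P < 1" using l by (simp add: k pinch_def)
  {
    assume le: "p \<le> q"
    have "pinch ((real q)\<^sup>2 / (real p)\<^sup>2) \<le> pinch l" using l b1(2)[OF le] by (intro pinch_antimono) auto
    then show "1/4 - 3/4 * (((real q)^2 - (real p)^2) / ((real p)^2 + (real q)^2)) \<le> pinching p q P"
      using pq by (simp add: k pinch_quotient) (simp add: diff_divide_distrib)
    \<comment> \<open>The stated bound is the value of \<open>pinch\<close> at the fourth power of
      p/q, which is at most p/q here.\<close>
    have "(real p / real q)^4 \<le> real p / real q"
      using power_decreasing[of 1 4 "real p / real q"] le pq by simp
    then have "(real p)^4 / (real q)^4 \<le> l" using b1(1)[OF le] by (simp add: power_divide)
    then have "pinch l \<le> pinch ((real p)^4 / (real q)^4)" by (intro pinch_antimono) auto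
    then show "pinching p q P \<le> 1/4 + 3/4 * (((real q)^4 - (real p)^4) / ((real p)^4 + (real q)^4))"
      using pq by (simp add: k pinch_quotient add.commute)
  }
  {
    assume le: "p \<ge> q"
    have "real p / real q \<le> (real p / real q)^4"
      using power_increasing[of 1 4 "real p / real q"] le pq by simp
    then have "l \<le> (real p)^4 / (real q)^4" using b2(2)[OF le] by (simp add: power_divide)
    then have "pinch ((real p)^4 / (real q)^4) \<le> pinch l" using l by (intro pinch_antimono) auto
    then show "1/4 - 3/4 * (((real p)^4 - (real q)^4) / ((real p)^4 + (real q)^4)) \<le> pinching p q P"
      using pq by (simp add: k pinch_quotient) (simp add: diff_divide_distrib add.commute)
    have "pinch l \<le> pinch ((real q)\<^sup>2 / (real p)\<^sup>2)" using b2(1)[OF le] by (intro pinch_antimono) auto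
    then show "pinching p q P \<le> 1/4 + 3/4 * (((real p)^2 - (real q)^2) / ((real p)^2 + (real q)^2))"
      using pq by (simp add: k pinch_quotient)
  }
next
  fix \<epsilon> :: real assume \<epsilon>: "\<epsilon> > 0"
  \<comment> \<open>The bound 1/2 keeps t = p/q in [1/2, 3/2], where 1/t^2 differs from 1 by at most
    10 \<delta>; the factor 20 leaves room for a strict inequality.\<close>
  define \<delta> where "\<delta> = min (1/2) (\<epsilon> / 20)"
  have \<delta>: "\<delta> > 0" "\<delta> \<le> 1/2" "20 * \<delta> \<le> \<epsilon>" using \<epsilon> by (auto simp: \<delta>_def)
  have "\<bar>pinching p q P - 1/4\<bar> < \<epsilon>"
    if adm: "admissible p q" and near: "\<bar>real p / real q - 1\<bar> < \<delta>" and P: "P \<in> GL_orbifold p q" for p q P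
  proof -
    obtain l where k: "pinching p q P = pinch l" and l: "0 < l" "l < 2"
      and b1: "p \<le> q \<Longrightarrow> real p / real q \<le> l" "p \<le> q \<Longrightarrow> l \<le> (real q)\<^sup>2 / (real p)\<^sup>2"
      and b2: "q \<le> p \<Longrightarrow> (real q)\<^sup>2 / (real p)\<^sup>2 \<le> l" "q \<le> p \<Longrightarrow> l \<le> real p / real q"
      using admissible_lam[OF adm P] by blast
    have pq: "real p > 0" "real q > 0" using adm by (auto simp: admissible_def)
    define t where "t = real p / real q"
    define r where "r = (real q)\<^sup>2 / (real p)\<^sup>2"
    have t: "\<bar>t - 1\<bar> < \<delta>" "1/2 \<le> t" "t \<le> 3/2" using near \<delta> unfolding t_def[symmetric] by linarith+
    have r: "r * t\<^sup>2 = 1" using pq by (simp add: r_def t_def power_divide)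
    have t4: "1/4 \<le> t\<^sup>2" using power_mono[OF t(2), of 2] by (simp add: power2_eq_square)
    have "\<bar>r - 1\<bar> * (1/4) \<le> \<bar>r - 1\<bar> * t\<^sup>2" using t4 by (intro mult_left_mono) auto
    also have "\<dots> = \<bar>(r - 1) * t\<^sup>2\<bar>" by (simp add: abs_mult)
    also have "(r - 1) * t\<^sup>2 = (1 - t) * (1 + t)" using r by (simp add: algebra_simps power2_eq_square)
    also have "\<bar>(1 - t) * (1 + t)\<bar> = \<bar>t - 1\<bar> * \<bar>1 + t\<bar>" by (simp add: abs_mult abs_minus_commute)
    also have "\<dots> \<le> \<delta> * (5/2)" using t by (intro mult_mono) auto
    finally have "\<bar>r - 1\<bar> \<le> 10 * \<delta>" by simp
    moreover have "\<bar>t - 1\<bar> \<le> 10 * \<delta>" using t(1) \<delta> by simp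
    moreover have "t \<le> l \<and> l \<le> r \<or> r \<le> l \<and> l \<le> t"
      using b1 b2 by (cases "p \<le> q") (auto simp: t_def r_def)
    ultimately have "\<bar>l - 1\<bar> \<le> 10 * \<delta>" by linarith
    then show ?thesis using pinch_near_quarter[of l] l \<delta> by (simp add: k)
  qed
  then show "\<exists>\<delta>>0. \<forall>p q. admissible p q \<and> \<bar>real p / real q - 1\<bar> < \<delta> \<longrightarrow>
          (\<forall>P\<in>GL_orbifold p q. \<bar>pinching p q P - 1/4\<bar> < \<epsilon>)"
    using \<delta>(1) by blast
next
  fix p q assume adm: "admissible p q"
  have pq: "p > 0" "q > 0" using adm by (auto simp: admissible_def)
  show "(\<forall>P\<in>GL_orbifold p q. pinching p q P = 1/4) \<longleftrightarrow> p = 1 \<and> q = 1"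
  proof
    assume all: "\<forall>P\<in>GL_orbifold p q. pinching p q P = 1/4"
    \<comment> \<open>A point of the level with first entry 0: conjugating \<open>unit_j\<close> by
      1 and by the unit i gives opposite values. There \<open>lam\<close> is
      \<open>q^2 / p^2\<close>, which equals 1 only for \<open>p = q\<close>.\<close>
    define u :: quat3 where "u = (0, Quat (1 / sqrt 2) 0 0 0, Quat 0 (1 / sqrt 2) 0 0)"
    have u: "u \<in> level p q"
      by (simp add: level_def sphere11_iff u_def inner_prod_def inner_quat_def quat_eq_iff)
    interpret level_point p q u by unfold_locales (use pq u in auto)
    define P where "P = circle_orbit p q (hp_class u)"
    have "hp_class u \<in> LH p q" using u unfolding LH_def level_def by blast
    then have "P \<in> GL_orbifold p q" by (simp add: P_def GL_orbifold_def)
    then have "pinch lam = 1/4" using all unfolding pinch_def pinching_eq[OF P_def, symmetric] by blast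
    then have "lam = 1" using pinch_eq_quarter lam_pos by simp
    moreover have "fst u = 0" by (simp add: u_def)
    then have "nu2 = (real p)\<^sup>2" by (simp add: nu2_eq)
    ultimately have "(real p)^4 * (real q)\<^sup>2 = ((real p)\<^sup>2)^3" using pq by (simp add: lam_def)
    also have "\<dots> = (real p)^4 * (real p)\<^sup>2" by (simp flip: power_mult power_add)
    finally have "(real q)\<^sup>2 = (real p)\<^sup>2"
      by (rule mult_left_cancel[THEN iffD1, rotated]) (use pq in simp)
    then have "p = q" by simp
    then show "p = 1 \<and> q = 1" using adm by (simp add: admissible_def)
  next
    assume "p = 1 \<and> q = 1"
    then have 1: "p = 1" "q = 1" by auto
    show "\<forall>P\<in>GL_orbifold p q. pinching p q P = 1/4"
    proof
      fix P assume P: "P \<in> GL_orbifold p q"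
      obtain l where "pinching p q P = pinch l" "1 \<le> l" "l \<le> 1"
        using admissible_lam[OF adm P] 1 by auto
      then show "pinching p q P = 1/4" by (simp add: pinch_def)
    qed
  qed
qed

end
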